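(* Let $f=N_f/D_f$ and $g=N_g/D_g$ be real rational functions, where $N_f,D_f,N_g,D_g\in\mathbb{R}[x]$ satisfy $D_f(0)=1$, $D_g(0)=1$, $\gcd(N_f,D_f)=1$, $\gcd(N_g,D_g)=1$. Assume that $g(0)=0$, $g'(0)=1$ and $xg(x)>0$ in a punctured neighborhood of $0\in\mathbb{R}$. Then there exists a positive integer $M_0$ such that for any integer $M\ge M_0$ the following assertions are equivalent: 1. the origin $O=(0,0)$ of the planar system $$\dot x=y,\qquad \dot y=-g(x)-f(x)y^2$$ is an isochronous center; 2. there exists a real analytic odd function $h$ (defined in a neighborhood of $0$) satisfying $P_k(0)=Q_k(0)$ for all $0\le k\le M$, where $$P_0(\xi)=\xi,\qquad P_k(\xi)=\frac{dP_{k-1}(\xi)}{d\xi}\,(1+h(\xi))-(2k-1)\,P_{k-1}(\xi)\,\frac{dh(\xi)}{d\xi}\quad(k\ge1),$$ $$Q_0(x)=N_g(x),$$ $$Q_k(x)=Q_{k-1}(x)\,D_g(x)\left((1-k)\frac{dD_f(x)}{dx}+(2-k)N_f(x)\right)-k\,Q_{k-1}(x)\,\frac{dD_g(x)}{dx}\,D_f(x)+\frac{dQ_{k-1}(x)}{dx}\,D_g(x)\,D_f(x)\quad(k\ge1).$$ Moreover, since only the values of the $P_k$ and $Q_k$ at $0$ are needed, it is sufficient to compute the power series expansions of $P_k$ and $Q_k$ at $0$ up to order $M-k$. That is, if $P_0^{[M]}$, $Q_0^{[M]}$ are the truncations of $P_0$, $Q_0$ up to degree $M$, and for $1\le k\le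 M$ one lets $P_k^{[M]}$, $Q_k^{[M]}$ be the truncations up to degree $M-k$ of, respectively, $$\frac{dP_{k-1}^{[M]}(\xi)}{d\xi}\,(1+h(\xi))-(2k-1)\,P_{k-1}^{[M]}(\xi)\,\frac{dh(\xi)}{d\xi}$$ and $$Q_{k-1}^{[M]}(x)\,D_g(x)\left((1-k)\frac{dD_f(x)}{dx}+(2-k)N_f(x)\right)-k\,Q_{k-1}^{[M]}(x)\,\frac{dD_g(x)}{dx}\,D_f(x)+\frac{dQ_{k-1}^{[M]}(x)}{dx}\,D_g(x)\,D_f(x),$$ then $P_k^{[M]}(0)=P_k(0)$ and $Q_k^{[M]}(0)=Q_k(0)$ for $0\le k\le M$.
   Context: The system is the planar system associated with the Liénard type equation $\ddot x+f(x)\dot x^2+g(x)=0$. Under the hypotheses the origin is a center, i.e. it has a punctured neighborhood filled with nonconstant periodic orbits surrounding it; the center is isochronous if all periodic orbits in some neighborhood of the origin have the same period. The truncation up to degree $n$ of a function analytic at $0$ is its Taylor polynomial at $0$ of degree at most $n$. *)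

theory Defs
  imports "HOL-Analysis.Analysis"
begin

type_synonym plane = "real \<times> real"

definition is_period :: "(real \<Rightarrow> plane) \<Rightarrow> real \<Rightarrow> bool" where
  "is_period \<gamma> T \<longleftrightarrow> T > 0 \<and> (\<forall>t. \<gamma> (t + T) = \<gamma> t)"

definition is_least_period :: "(real \<Rightarrow> plane) \<Rightarrow> real \<Rightarrow> bool" where
  "is_least_period \<gamma> T \<longleftrightarrow> is_period \<gamma> T \<and> (\<forall>s. is_period \<gamma> s \<longrightarrow> T \<le> s)"

text \<open>The set \<open>S\<close> is the domain of the vector field \<open>V\<close>; values of \<open>V\<close> outside \<open>S\<close> are
  irrelevant. A nonconstant periodic orbit is the range of such a \<open>\<gamma>\<close>.\<close>

definition periodic_solution :: "plane set \<Rightarrow> (plane \<Rightarrow> plane) \<Rightarrow> (real \<Rightarrow> plane) \<Rightarrow> bool" where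
  "periodic_solution S V \<gamma> \<longleftrightarrow>
     (\<forall>t. \<gamma> t \<in> S \<and> (\<gamma> has_vector_derivative V (\<gamma> t)) (at t)) \<and>
     (\<exists>T. is_period \<gamma> T) \<and> \<not> \<gamma> constant_on UNIV"

text \<open>A punctured neighbourhood of \<open>p\<close> is the union of nonconstant periodic orbits surrounding
  \<open>p\<close> (\<open>\<gamma>\<close> avoids \<open>p\<close> because \<^term>\<open>inside A\<close> is disjoint from \<^term>\<open>A\<close>).\<close>

definition is_center :: "plane set \<Rightarrow> (plane \<Rightarrow> plane) \<Rightarrow> plane \<Rightarrow> bool" where
  "is_center S V p \<longleftrightarrow>
     (\<exists>U. open U \<and> p \<in> U \<and>
       (\<forall>q \<in> U - {p}. \<exists>\<gamma>. periodic_solution S V \<gamma> \<and> q \<in> range \<gamma> \<and> range \<gamma> \<subseteq> U \<and>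
          p \<in> inside (range \<gamma>)))"

definition is_isochronous_center :: "plane set \<Rightarrow> (plane \<Rightarrow> plane) \<Rightarrow> plane \<Rightarrow> bool" where
  "is_isochronous_center S V p \<longleftrightarrow>
     is_center S V p \<and>
     (\<exists>U T. open U \<and> p \<in> U \<and>
       (\<forall>\<gamma>. periodic_solution S V \<gamma> \<and> range \<gamma> \<subseteq> U \<longrightarrow> is_least_period \<gamma> T))"

definition lienard_field :: "(real \<Rightarrow> real) \<Rightarrow> (real \<Rightarrow> real) \<Rightarrow> plane \<Rightarrow> plane" where
  "lienard_field f g = (\<lambda>(x, y). (y, - g x - f x * y\<^sup>2))"

text \<open>For a real function, having a power series expansion at 0 of positive radius of convergence
  is the same as being real analytic in a neighbourhood of 0.\<close>

definition odd_analytic_at_0 :: "(real \<Rightarrow> real) \<Rightarrow> bool" where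
  "odd_analytic_at_0 h \<longleftrightarrow>
     (\<exists>F. h has_fps_expansion F) \<and> (\<forall>\<^sub>F \<xi> in nhds 0. h (- \<xi>) = - h \<xi>)"

fun P_seq :: "(real \<Rightarrow> real) \<Rightarrow> nat \<Rightarrow> real \<Rightarrow> real" where
  "P_seq h 0 = (\<lambda>\<xi>. \<xi>)"
| "P_seq h (Suc j) = (let k = real (Suc j) in
     (\<lambda>\<xi>. deriv (P_seq h j) \<xi> * (1 + h \<xi>) - (2 * k - 1) * P_seq h j \<xi> * deriv h \<xi>))"

definition Q_step ::
    "real poly \<Rightarrow> real poly \<Rightarrow> real poly \<Rightarrow> real \<Rightarrow> real poly \<Rightarrow> real poly" where
  "Q_step Nf Df Dg k q =
     q * Dg * (smult (1 - k) (pderiv Df) + smult (2 - k) Nf)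
     - smult k (q * pderiv Dg * Df)
     + pderiv q * Dg * Df"

fun Q_seq :: "real poly \<Rightarrow> real poly \<Rightarrow> real poly \<Rightarrow> real poly \<Rightarrow> nat \<Rightarrow> real poly" where
  "Q_seq Nf Df Ng Dg 0 = Ng"
| "Q_seq Nf Df Ng Dg (Suc j) = Q_step Nf Df Dg (real (Suc j)) (Q_seq Nf Df Ng Dg j)"

text \<open>Taylor polynomial at 0 of degree at most \<open>n\<close>.\<close>

definition truncation :: "nat \<Rightarrow> (real \<Rightarrow> real) \<Rightarrow> real poly" where
  "truncation n u = (\<Sum>i\<le>n. monom ((deriv ^^ i) u 0 / fact i) i)"

text \<open>The truncated sequences are meaningful for \<open>k \<le> M\<close> only, where the natural-number
  subtraction \<open>M - k\<close> is the true one.\<close>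

fun P_trunc :: "(real \<Rightarrow> real) \<Rightarrow> nat \<Rightarrow> nat \<Rightarrow> real poly" where
  "P_trunc h M 0 = truncation M (P_seq h 0)"
| "P_trunc h M (Suc j) = (let k = real (Suc j) in
     truncation (M - Suc j)
       (\<lambda>\<xi>. poly (pderiv (P_trunc h M j)) \<xi> * (1 + h \<xi>)
             - (2 * k - 1) * poly (P_trunc h M j) \<xi> * deriv h \<xi>))"

fun Q_trunc ::
    "real poly \<Rightarrow> real poly \<Rightarrow> real poly \<Rightarrow> real poly \<Rightarrow> nat \<Rightarrow> nat \<Rightarrow> real poly" where
  "Q_trunc Nf Df Ng Dg M 0 = truncation M (poly (Q_seq Nf Df Ng Dg 0))"
| "Q_trunc Nf Df Ng Dg M (Suc j) =
     truncation (M - Suc j)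
       (poly (Q_step Nf Df Dg (real (Suc j)) (Q_trunc Nf Df Ng Dg M j)))"

end

theory Submission
  imports Defs "HOL-Complex_Analysis.Complex_Analysis"
begin

text \<open>
  Let \<open>F = \<integral> f\<close> and \<open>u = \<integral> e\<^sup>F\<close>. In the variable \<open>u\<close> the equation becomes
  \<open>u'' + G = 0\<close> with \<open>G = g e\<^sup>F\<close>. Let \<open>\<xi>\<close> be the analytic function of \<open>x\<close> with the sign of
  \<open>x\<close> and \<open>\<xi>\<^sup>2 / 2 = \<integral> G du = \<integral> g e\<^sup>2\<^sup>F dx\<close>, and write \<open>du/d\<xi> = 1 + h(\<xi>)\<close>, so that
  \<open>G (1 + h(\<xi>)) = \<xi>\<close>. With \<open>v = u' = y e\<^sup>F\<close>, the orbits are the circles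
  \<open>\<xi> = r sin \<theta>\<close>, \<open>v = r cos \<theta>\<close>, described with \<open>dt = (1 + h(r sin \<theta>)) d\<theta>\<close>. Hence the period
  of the circle of radius \<open>r\<close> is \<open>\<tau>(\<pi>) - \<tau>(-\<pi>)\<close> for a primitive \<open>\<tau>\<close> of
  \<open>1 + h(r sin \<theta>)\<close>, and only the even part of \<open>h\<close> contributes to it. By the mean value theorem the
  period is \<open>\<pi> (2 + h(s) + h(-s))\<close> for some \<open>0 < s \<le> r\<close>. If it does not depend on \<open>r\<close>, then the
  analytic function \<open>h(s) + h(-s)\<close> takes one and the same value at points arbitrarily close to \<open>0\<close>,
  so it is constant, equal to \<open>2 h(0) = 0\<close>. This is Urabe's criterion: the center is isochronous if
  and only if \<open>h\<close> is odd (\<open>isochronous_imp_odd\<close>, \<open>odd_imp_isochronous\<close>).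

  Both sequences of the theorem compute the derivatives of \<open>G\<close> with respect to \<open>u\<close>: by induction
  \<open>d\<^sup>kG/du\<^sup>k\<close> is \<open>P\<^sub>k(\<xi>) / (1 + h(\<xi>))\<^sup>2\<^sup>k\<^sup>+\<^sup>1\<close> on the one hand, and
  \<open>Q\<^sub>k(x) e\<^sup>(\<^sup>1\<^sup>-\<^sup>k\<^sup>)\<^sup>F / (D\<^sub>g\<^sup>k\<^sup>+\<^sup>1 D\<^sub>f\<^sup>k)\<close> on the other (\<open>P_seq_eq_Q_seq\<close>). So
  \<open>P\<^sub>k(0) = Q\<^sub>k(0)\<close> holds for all \<open>k\<close> when \<open>h\<close> is the function just constructed, odd or not.
  Conversely, the values \<open>P\<^sub>0(0), \<dots>, P\<^sub>M(0)\<close> determine the coefficients of order below \<open>M\<close> of a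
  power series \<open>h\<close> with \<open>h(0) = 0\<close>, because the coefficient of order \<open>n\<close> enters
  \<open>P\<^sub>n\<^sub>+\<^sub>1(0)\<close> linearly with a nonzero factor (\<open>formal_P_determines\<close>). If the center is isochronous,
  then \<open>h\<close> itself is a witness for every \<open>M\<close>. If it is not, then \<open>h\<close> has a nonzero coefficient of
  some even order \<open>n\<close>, and no odd function can match the values \<open>Q\<^sub>k(0)\<close> up to any \<open>M \<ge> n + 1\<close>.

  The truncated recursions give the same values at \<open>0\<close> because every step of the recursion loses
  exactly one order of accuracy.
\<close>

section \<open>Real functions with a power series expansion\<close>

lemma has_fps_expansion_at_0:
  fixes u :: "real \<Rightarrow> real"
  assumes "u has_fps_expansion U"
  shows "u 0 = fps_nth U 0"
  using assms by (auto simp: has_fps_expansion_def eval_fps_at_0 dest: eventually_nhds_x_imp_x)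

lemma has_fps_expansion_poly:
  "poly (p :: real poly) has_fps_expansion fps_of_poly p"
  by (simp add: has_fps_expansion_def)

lemma higher_deriv_has_fps_expansion:
  fixes u :: "real \<Rightarrow> real"
  assumes "u has_fps_expansion U"
  shows "(deriv ^^ n) u has_fps_expansion (fps_deriv ^^ n) U"
  by (induction n) (auto intro!: fps_expansion_intros assms)

lemma fps_nth_eq_higher_deriv:
  fixes u :: "real \<Rightarrow> real"
  assumes "u has_fps_expansion U"
  shows "(deriv ^^ n) u 0 / fact n = fps_nth U n"
proof -
  have "fps_nth ((fps_deriv ^^ n) U) m = pochhammer (real (m + 1)) n * fps_nth U (n + m)" for m
  proof (induction n arbitrary: m)
    case (Suc n)
    show ?case
      by (simp add: Suc pochhammer_rec add_ac)
  qed simp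
  hence "fps_nth ((fps_deriv ^^ n) U) 0 = fact n * fps_nth U n" 
    by (simp add: pochhammer_fact)
  with has_fps_expansion_at_0[OF higher_deriv_has_fps_expansion[OF assms, of n]]
  show ?thesis by simp
qed

lemma has_fps_expansion_imp_differentiable:
  fixes p :: "real \<Rightarrow> real"
  assumes "p has_fps_expansion P"
  shows "\<forall>\<^sub>F x in nhds 0. (p has_real_derivative deriv p x) (at x)"
proof -
  have "\<forall>\<^sub>F x in nhds 0. x \<in> eball 0 (fps_conv_radius P)"
    using assms by (intro eventually_nhds_in_open) (auto simp: has_fps_expansion_def zero_ereal_def)
  moreover have "\<forall>\<^sub>F x in nhds 0. \<forall>\<^sub>F y in nhds x. eval_fps P y = p y"
    using assms by (simp add: has_fps_expansion_def eventually_eventually)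
  ultimately show ?thesis
  proof eventually_elim
    case (elim x)
    have "(eval_fps P has_field_derivative eval_fps (fps_deriv P) x) (at x)"
      using elim(1) by (intro has_field_derivative_eval_fps) auto
    hence "(p has_field_derivative eval_fps (fps_deriv P) x) (at x)"
      using elim(2) by (simp add: DERIV_cong_ev)
    thus ?case using DERIV_imp_deriv by metis
  qed
qed

lemma fps_nth_1_eq_deriv:
  fixes p :: "real \<Rightarrow> real"
  assumes "p has_fps_expansion P" "(p has_real_derivative d) (at 0)"
  shows "fps_nth P 1 = d"
  using has_fps_expansion_at_0[OF has_fps_expansion_deriv[OF assms(1)]] DERIV_imp_deriv[OF assms(2)]
  by simp

lemma eventually_nhds_0_interval:
  assumes "\<forall>\<^sub>F x in nhds (0::real). Q x"
  obtains d where "d > 0" "\<And>x. \<bar>x\<bar> \<le> d \<Longrightarrow> Q x"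
proof -
  from assms obtain e where e: "e > 0" "\<And>x. dist x 0 < e \<Longrightarrow> Q x"
    by (auto simp: eventually_nhds_metric)
  show ?thesis by (rule that[of "e/2"]) (use e in auto)
qed

lemma eventually_of_real:
  assumes "\<forall>\<^sub>F z in nhds (0::complex). Q z"
  shows "\<forall>\<^sub>F x in nhds (0::real). Q (of_real x)"
  using eventually_compose_filterlim[OF assms, of complex_of_real "nhds 0"]
    tendsto_of_real[OF filterlim_ident, of "0::real"] by simp

text \<open>Real analytic functions are handled as restrictions of holomorphic ones: a real power series
  converges on a complex disc as well, and conversely the real part of a holomorphic function
  restricted to the real line has a power series expansion. This transports composition and local
  inversion from complex analysis to the real line.\<close>
lemma complexification:
  fixes p :: "real \<Rightarrow> real"
  assumes "p has_fps_expansion P"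
  obtains \<phi> where "\<phi> has_fps_expansion (Abs_fps (\<lambda>n. complex_of_real (fps_nth P n)))"
    and "\<forall>\<^sub>F x in nhds 0. \<phi> (of_real x) = of_real (p x)"
proof -
  define C where "C = Abs_fps (\<lambda>n. complex_of_real (fps_nth P n))"
  have "conv_radius (fps_nth C) = conv_radius (\<lambda>n. norm (fps_nth C n))" by simp
  also have "(\<lambda>n. norm (fps_nth C n)) = (\<lambda>n. norm (fps_nth P n))" by (simp add: C_def)
  also have "conv_radius (\<lambda>n. norm (fps_nth P n)) = conv_radius (fps_nth P)" by (rule conv_radius_norm)
  finally have rad: "fps_conv_radius C = fps_conv_radius P"
    by (simp add: fps_conv_radius_def)
  have "eval_fps C has_fps_expansion C"
    using assms by (intro eval_fps_has_fps_expansion) (simp add: rad has_fps_expansion_def)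
  moreover have "\<forall>\<^sub>F x in nhds 0. x \<in> eball 0 (fps_conv_radius P)"
    using assms by (intro eventually_nhds_in_open) (auto simp: has_fps_expansion_def zero_ereal_def)
  hence "\<forall>\<^sub>F x in nhds 0. eval_fps C (of_real x) = of_real (p x)"
    using assms[unfolded has_fps_expansion_def, THEN conjunct2]
  proof eventually_elim
    case (elim x)
    have "(\<lambda>n. fps_nth P n * x ^ n) sums eval_fps P x"
      using elim(1) by (intro sums_eval_fps) auto
    hence "(\<lambda>n. complex_of_real (fps_nth P n * x ^ n)) sums of_real (p x)"
      using elim(2) by (subst sums_of_real_iff) simp
    moreover have "(\<lambda>n. fps_nth C n * of_real x ^ n) sums eval_fps C (of_real x)"
      using elim(1) by (intro sums_eval_fps) (auto simp: rad)
    ultimately show ?case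
      by (simp add: C_def) (metis sums_unique2)
  qed
  ultimately show ?thesis using that by (simp add: C_def)
qed

lemma Re_analytic_has_fps_expansion:
  assumes "\<phi> analytic_on {0}"
  obtains P where "(\<lambda>x::real. Re (\<phi> (of_real x))) has_fps_expansion P"
proof -
  obtain C where C: "\<phi> has_fps_expansion C"
    using analytic_at_imp_has_fps_expansion_0[OF assms] by blast
  have "\<forall>\<^sub>F z in nhds 0. z \<in> eball 0 (fps_conv_radius C)"
    using C by (intro eventually_nhds_in_open) (auto simp: has_fps_expansion_def zero_ereal_def)
  hence "\<forall>\<^sub>F z in nhds 0. (\<lambda>n. fps_nth C n * z ^ n) sums \<phi> z"
    using C[unfolded has_fps_expansion_def, THEN conjunct2]
  proof eventually_elim
    case (elim z)
    show ?case using sums_eval_fps[of z C] elim by simp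
  qed
  hence "\<forall>\<^sub>F x in nhds 0. (\<lambda>n. Re (fps_nth C n) * x ^ n) sums Re (\<phi> (of_real x))"
    by (rule eventually_mono[OF eventually_of_real]) 
      (auto dest!: sums_Re simp flip: of_real_power)
  hence "(\<lambda>x::real. Re (\<phi> (of_real x))) has_fps_expansion Abs_fps (\<lambda>n. Re (fps_nth C n))"
    by (intro has_fps_expansionI) simp
  thus ?thesis using that by blast
qed

lemma has_fps_expansion_via_complex:
  fixes p :: "real \<Rightarrow> real"
  assumes "\<phi> analytic_on {0}" "\<forall>\<^sub>F x in nhds 0. p x = Re (\<phi> (of_real x))"
  shows "\<exists>P. p has_fps_expansion P"
  using Re_analytic_has_fps_expansion[OF assms(1)] has_fps_expansion_cong[OF assms(2)] by metis

lemma has_fps_expansion_compose_real: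
  fixes p q :: "real \<Rightarrow> real"
  assumes p: "p has_fps_expansion P" and q: "q has_fps_expansion Q" and "q 0 = 0"
  shows "\<exists>R. (\<lambda>x. p (q x)) has_fps_expansion R"
proof -
  obtain \<phi> where \<phi>: "\<phi> has_fps_expansion (Abs_fps (\<lambda>n. complex_of_real (fps_nth P n)))"
    and \<phi>p: "\<forall>\<^sub>F x in nhds 0. \<phi> (of_real x) = of_real (p x)" by (rule complexification[OF p])
  obtain \<psi> where \<psi>: "\<psi> has_fps_expansion (Abs_fps (\<lambda>n. complex_of_real (fps_nth Q n)))"
    and \<psi>q: "\<forall>\<^sub>F x in nhds 0. \<psi> (of_real x) = of_real (q x)" by (rule complexification[OF q])
  have "\<psi> 0 = 0" using eventually_nhds_x_imp_x[OF \<psi>q] \<open>q 0 = 0\<close> by simp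
  hence "(\<phi> \<circ> \<psi>) analytic_on {0}"
    using has_fps_expansion_imp_analytic_0[OF \<phi>] has_fps_expansion_imp_analytic_0[OF \<psi>]
    by (intro analytic_on_compose) simp_all
  hence "(\<lambda>z. \<phi> (\<psi> z)) analytic_on {0}" by (simp only: comp_def)
  moreover have "filterlim q (nhds 0) (nhds 0)"
    using has_fps_expansion_imp_continuous[OF q, of UNIV] \<open>q 0 = 0\<close>
    by (metis UNIV_I continuous_at isCont_def tendsto_at_iff_tendsto_nhds)
  with \<phi>p have "\<forall>\<^sub>F x in nhds 0. \<phi> (of_real (q x)) = of_real (p (q x))"
    by (rule eventually_compose_filterlim)
  with \<psi>q have "\<forall>\<^sub>F x in nhds 0. p (q x) = Re (\<phi> (\<psi> (of_real x)))"
    by eventually_elim simp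
  ultimately show ?thesis by (rule has_fps_expansion_via_complex)
qed

lemma has_fps_expansion_exp_compose:
  fixes p :: "real \<Rightarrow> real"
  assumes "p has_fps_expansion P"
  shows "\<exists>R. (\<lambda>x. exp (p x)) has_fps_expansion R"
proof -
  obtain \<phi> where \<phi>: "\<phi> has_fps_expansion (Abs_fps (\<lambda>n. complex_of_real (fps_nth P n)))"
    and \<phi>p: "\<forall>\<^sub>F x in nhds 0. \<phi> (of_real x) = of_real (p x)" by (rule complexification[OF assms])
  have "(\<lambda>z. exp (\<phi> z)) analytic_on {0}"
    using has_fps_expansion_imp_analytic_0[OF \<phi>] by (intro analytic_intros)
  moreover have "\<forall>\<^sub>F x in nhds 0. exp (p x) = Re (exp (\<phi> (of_real x)))"
    using \<phi>p by eventually_elim (simp add: exp_of_real)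
  ultimately show ?thesis by (rule has_fps_expansion_via_complex)
qed

lemma has_fps_expansion_sqrt_compose:
  fixes p :: "real \<Rightarrow> real"
  assumes p: "p has_fps_expansion P" and "p 0 > 0"
  shows "\<exists>R. (\<lambda>x. sqrt (p x)) has_fps_expansion R"
proof -
  obtain \<phi> where \<phi>: "\<phi> has_fps_expansion (Abs_fps (\<lambda>n. complex_of_real (fps_nth P n)))"
    and \<phi>p: "\<forall>\<^sub>F x in nhds 0. \<phi> (of_real x) = of_real (p x)" by (rule complexification[OF p])
  have "\<phi> 0 = of_real (p 0)" using eventually_nhds_x_imp_x[OF \<phi>p] by simp
  hence "(\<lambda>z. csqrt (\<phi> z)) analytic_on {0}"
    using has_fps_expansion_imp_analytic_0[OF \<phi>] \<open>p 0 > 0\<close>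
    by (intro analytic_intros) auto
  moreover have "isCont p 0" using has_fps_expansion_imp_continuous[OF p, of UNIV] by simp
  hence "filterlim p (nhds (p 0)) (nhds 0)"
    by (simp add: continuous_at tendsto_at_iff_tendsto_nhds)
  hence "\<forall>\<^sub>F x in nhds 0. p x > 0" using \<open>p 0 > 0\<close> by (rule order_tendstoD)
  with \<phi>p have "\<forall>\<^sub>F x in nhds 0. sqrt (p x) = Re (csqrt (\<phi> (of_real x)))"
    by eventually_elim (simp add: of_real_sqrt[symmetric])
  ultimately show ?thesis by (rule has_fps_expansion_via_complex)
qed

lemma has_fps_expansion_primitive:
  fixes p :: "real \<Rightarrow> real"
  assumes "p has_fps_expansion P"
  obtains q Q where "q has_fps_expansion Q" "q 0 = 0"
    "\<forall>\<^sub>F x in nhds 0. (q has_field_derivative p x) (at x)"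
proof -
  obtain \<phi> where \<phi>: "\<phi> has_fps_expansion (Abs_fps (\<lambda>n. complex_of_real (fps_nth P n)))"
    and \<phi>p: "\<forall>\<^sub>F x in nhds 0. \<phi> (of_real x) = of_real (p x)" by (rule complexification[OF assms])
  obtain r where r: "r > 0" "\<phi> holomorphic_on ball 0 r"
    using has_fps_expansion_imp_analytic_0[OF \<phi>] by (auto simp: analytic_on_def)
  obtain \<Phi> where \<Phi>: "\<And>z. z \<in> ball 0 r \<Longrightarrow> (\<Phi> has_field_derivative \<phi> z) (at z)"
    using holomorphic_convex_primitive'[OF convex_ball open_ball r(2)] by (metis at_within_open convex_ball open_ball)
  have "\<Phi> holomorphic_on ball 0 r"
    using \<Phi> unfolding holomorphic_on_open[OF open_ball] by blast
  hence "(\<lambda>z. \<Phi> z - \<Phi> 0) analytic_on {0}"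
    using r(1) by (intro analytic_intros) (auto simp: analytic_on_def)
  then obtain Q where Q: "(\<lambda>x::real. Re (\<Phi> (of_real x) - \<Phi> 0)) has_fps_expansion Q"
    by (rule Re_analytic_has_fps_expansion)
  have "\<forall>\<^sub>F x in nhds (0::real). x \<in> ball 0 r"
    using r(1) by (intro eventually_nhds_in_open) auto
  with \<phi>p have "\<forall>\<^sub>F x in nhds 0.
      ((\<lambda>x. Re (\<Phi> (of_real x) - \<Phi> 0)) has_field_derivative p x) (at x)"
  proof eventually_elim
    case (elim x)
    have "(\<Phi> has_field_derivative of_real (p x)) (at (of_real x))"
      using \<Phi>[of "of_real x"] elim by simp
    hence "((\<lambda>x. \<Phi> (of_real x)) has_vector_derivative of_real (p x)) (at x)"
      by (rule has_vector_derivative_real_field)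
    hence "((\<lambda>x. \<Phi> (of_real x) - \<Phi> 0) has_vector_derivative of_real (p x)) (at x)"
      by (auto intro!: derivative_eq_intros)
    from bounded_linear.has_vector_derivative[OF bounded_linear_Re this] show ?case
      by (simp add: has_real_derivative_iff_has_vector_derivative)
  qed
  from that[OF Q _ this] show ?thesis by simp
qed

text \<open>The holomorphic extension is locally biholomorphic. Its inverse is real on the image of the
  real line, so taking real parts yields a real analytic left inverse.\<close>
lemma has_fps_expansion_local_inverse:
  fixes p :: "real \<Rightarrow> real"
  assumes p: "p has_fps_expansion P" and "fps_nth P 0 = 0" "fps_nth P 1 \<noteq> 0"
  obtains q Q where "q has_fps_expansion Q" "\<forall>\<^sub>F x in nhds 0. q (p x) = x"
proof -
  obtain \<phi> where \<phi>: "\<phi> has_fps_expansion (Abs_fps (\<lambda>n. complex_of_real (fps_nth P n)))"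
    and \<phi>p: "\<forall>\<^sub>F x in nhds 0. \<phi> (of_real x) = of_real (p x)" by (rule complexification[OF p])
  have "p 0 = 0" using has_fps_expansion_at_0[OF p] assms by simp
  hence "\<phi> 0 = 0" using eventually_nhds_x_imp_x[OF \<phi>p] by simp
  have "deriv \<phi> 0 = of_real (fps_nth P 1)" using fps_nth_fps_expansion[OF \<phi>, of 1] by simp
  hence nz: "deriv \<phi> 0 \<noteq> 0" using assms(3) by simp
  obtain R where R: "R > 0" "\<phi> holomorphic_on ball 0 R"
    using has_fps_expansion_imp_analytic_0[OF \<phi>] by (auto simp: analytic_on_def)
  from R(1) have "0 \<in> ball (0::complex) R" by simp
  then obtain r where r: "r > 0" "ball (0::complex) r \<subseteq> ball 0 R" "open (\<phi> ` ball 0 r)"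
      "inj_on \<phi> (ball 0 r)"
    by (rule has_complex_derivative_locally_invertible[OF R(2) _ open_ball nz])
  then obtain \<psi> where \<psi>: "\<psi> holomorphic_on (\<phi> ` ball 0 r)" "\<And>z. z \<in> ball 0 r \<Longrightarrow> \<psi> (\<phi> z) = z"
    by (metis R(2) holomorphic_has_inverse holomorphic_on_subset open_ball)
  have "\<psi> analytic_on {0}"
    using \<psi>(1) r(1,3) \<open>\<phi> 0 = 0\<close> by (metis analytic_at centre_in_ball image_eqI)
  then obtain Q where Q: "(\<lambda>x::real. Re (\<psi> (of_real x))) has_fps_expansion Q"
    by (rule Re_analytic_has_fps_expansion)
  have "\<forall>\<^sub>F x in nhds (0::real). x \<in> ball 0 r"
    using r(1) by (intro eventually_nhds_in_open) auto
  with \<phi>p have "\<forall>\<^sub>F x in nhds 0. Re (\<psi> (of_real (p x))) = x"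
    by eventually_elim (metis Re_complex_of_real \<psi>(2) dist_0_norm mem_ball norm_of_real real_norm_def)
  with Q that show ?thesis by blast
qed

text \<open>Dividing by the power of \<open>x\<close> given by the subdegree leaves a function that is continuous and
  nonzero at \<open>0\<close>, so zeros are isolated.\<close>
lemma has_fps_expansion_eventually_nonzero:
  fixes p :: "real \<Rightarrow> real"
  assumes p: "p has_fps_expansion P" and "P \<noteq> 0"
  shows "\<forall>\<^sub>F x in at 0. p x \<noteq> 0"
proof -
  define d where "d = subdegree P"
  define q where "q = (\<lambda>x. if x = 0 then fps_nth P d else p x / x ^ d)"
  have "q has_fps_expansion fps_shift d P"
    unfolding q_def by (rule has_fps_expansion_shift[OF p]) (simp_all add: d_def)
  hence "isCont q 0" by (rule has_fps_expansion_imp_continuous)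
  moreover have "q 0 \<noteq> 0" using \<open>P \<noteq> 0\<close> by (simp add: q_def d_def)
  ultimately have "\<forall>\<^sub>F x in at 0. q x \<noteq> 0"
    unfolding isCont_def by (rule tendsto_imp_eventually_ne)
  moreover have "\<forall>\<^sub>F x in at (0::real). x \<noteq> 0" by (simp add: eventually_at_filter)
  ultimately show ?thesis by eventually_elim (auto simp: q_def)
qed

lemma even_part_has_fps_expansion:
  fixes h :: "real \<Rightarrow> real"
  assumes h: "h has_fps_expansion H"
  shows "(\<lambda>x. h x + h (- x)) has_fps_expansion
    Abs_fps (\<lambda>n. if even n then 2 * fps_nth H n else 0)"
proof (rule has_fps_expansionI)
  have "\<forall>\<^sub>F z in nhds 0. z \<in> eball 0 (fps_conv_radius H)"
    using h by (intro eventually_nhds_in_open) (auto simp: has_fps_expansion_def zero_ereal_def)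
  hence *: "\<forall>\<^sub>F z in nhds 0. (\<lambda>n. fps_nth H n * z ^ n) sums h z"
    using h[unfolded has_fps_expansion_def, THEN conjunct2]
  proof eventually_elim
    case (elim z)
    show ?case using sums_eval_fps[of z H] elim by simp
  qed
  have "filterlim uminus (nhds (0::real)) (nhds 0)"
    using tendsto_minus[OF filterlim_ident, of "0::real"] by simp
  from eventually_compose_filterlim[OF * this] *
  show "\<forall>\<^sub>F x in nhds 0. (\<lambda>n. fps_nth (Abs_fps (\<lambda>n. if even n then 2 * fps_nth H n else 0)) n * x ^ n)
      sums (h x + h (- x))"
  proof eventually_elim
    case (elim x)
    from sums_add[OF elim(2,1)] show ?case
      by (rule sums_cong[THEN iffD1, rotated]) (auto simp: power_minus_even power_minus_odd)
  qed
qed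

lemma odd_iff_even_coeffs_vanish:
  fixes h :: "real \<Rightarrow> real"
  assumes h: "h has_fps_expansion H"
  shows "(\<forall>\<^sub>F x in nhds 0. h (- x) = - h x) \<longleftrightarrow> (\<forall>n. even n \<longrightarrow> fps_nth H n = 0)"
proof
  let ?E = "Abs_fps (\<lambda>n. if even n then 2 * fps_nth H n else 0)"
  note E = even_part_has_fps_expansion[OF h]
  show "\<forall>n. even n \<longrightarrow> fps_nth H n = 0" if odd: "\<forall>\<^sub>F x in nhds 0. h (- x) = - h x"
  proof (rule ccontr)
    assume "\<not> ?thesis"
    hence "?E \<noteq> 0" by (auto simp: fps_eq_iff)
    from has_fps_expansion_eventually_nonzero[OF E this] 
    have "\<forall>\<^sub>F x in at 0. h x + h (- x) \<noteq> 0" .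
    moreover have "\<forall>\<^sub>F x in at 0. h (- x) = - h x"
      using odd by (simp add: eventually_at_filter eventually_mono)
    ultimately have "\<forall>\<^sub>F x in at (0::real). False" by eventually_elim simp
    thus False by simp
  qed
  show "\<forall>\<^sub>F x in nhds 0. h (- x) = - h x" if "\<forall>n. even n \<longrightarrow> fps_nth H n = 0"
  proof -
    have "?E = 0" using that by (auto simp: fps_eq_iff)
    hence "\<forall>\<^sub>F x in nhds 0. 0 = h x + h (- x)" using E by (simp add: has_fps_expansion_def)
    thus ?thesis by eventually_elim simp
  qed
qed

section \<open>The P-sequence as formal power series\<close>

text \<open>The power series expansion at \<open>0\<close> of \<^const>\<open>P_seq\<close>; it makes sense for an arbitrary formal
  power series in place of \<open>h\<close>.\<close>
fun formal_P :: "real fps \<Rightarrow> nat \<Rightarrow> real fps" where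
  "formal_P H 0 = fps_X"
| "formal_P H (Suc j) = fps_deriv (formal_P H j) * (1 + H)
     - fps_const (2 * real (Suc j) - 1) * formal_P H j * fps_deriv H"

lemma P_seq_has_fps_expansion:
  assumes "h has_fps_expansion H"
  shows "P_seq h k has_fps_expansion formal_P H k"
proof (induction k)
  case 0
  show ?case by (auto intro: fps_expansion_intros)
next
  case (Suc k)
  show ?case
    unfolding P_seq.simps formal_P.simps Let_def
    by (intro fps_expansion_intros Suc assms)
qed

lemma P_seq_at_0:
  assumes "h has_fps_expansion H"
  shows "P_seq h k 0 = fps_nth (formal_P H k) 0"
  by (rule has_fps_expansion_at_0[OF P_seq_has_fps_expansion[OF assms]])

text \<open>The lowest coefficient of a product when the first factor is known to vanish to order \<open>a\<close>.
  This is the only rule by which orders of vanishing are propagated below.\<close>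
lemma fps_nth_mult_lowest:
  fixes A B :: "real fps"
  assumes "\<And>i. i < a \<Longrightarrow> fps_nth A i = 0"
  shows "fps_nth (A * B) a = fps_nth A a * fps_nth B 0"
    and "i < a \<Longrightarrow> fps_nth (A * B) i = 0"
proof -
  have "fps_nth (A * B) a = (\<Sum>i=0..a. if i = a then fps_nth A a * fps_nth B 0 else 0)"
    unfolding fps_mult_nth by (intro sum.cong) (auto simp: assms)
  thus "fps_nth (A * B) a = fps_nth A a * fps_nth B 0" by simp
  show "fps_nth (A * B) i = 0" if "i < a"
    unfolding fps_mult_nth using that by (intro sum.neutral) (auto simp: assms)
qed

lemma formal_P_diff_step:
  "formal_P H (Suc k) - formal_P K (Suc k) =
     fps_deriv (formal_P H k - formal_P K k) * (1 + H)
     + (H - K) * fps_deriv (formal_P K k)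
     - fps_const (2 * real (Suc k) - 1) *
         ((formal_P H k - formal_P K k) * fps_deriv H + fps_deriv (H - K) * formal_P K k)"
  by (simp add: algebra_simps)

text \<open>Let \<open>H - K = d \<xi>\<^sup>n + \<dots>\<close>. The difference of the \<open>k\<close>-th terms then starts with
  \<open>c\<^sub>k d \<xi>\<^sup>n\<^sup>+\<^sup>1\<^sup>-\<^sup>k\<close>. Here \<open>c\<^sub>1 = 1 - n\<close>, which vanishes for \<open>n = 1\<close>, while
  \<open>c\<^sub>2 = n (1 - n) - 3n = - n (n + 2)\<close>. From \<open>k = 3\<close> on only the derivative of the previous difference
  reaches the lowest order, so that \<open>c\<^sub>k = (n + 2 - k) c\<^sub>k\<^sub>-\<^sub>1\<close>. For this reason the induction starts
  at \<open>k = 2\<close>; the factor stays nonzero up to \<open>k = n + 1\<close>, where the lowest order is \<open>0\<close>.\<close>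
lemma formal_P_leading_difference:
  fixes H K :: "real fps"
  assumes "fps_nth H 0 = 0" "fps_nth K 0 = 0" and "n \<ge> 1"
    and agree: "\<And>i. i < n \<Longrightarrow> fps_nth H i = fps_nth K i"
    and "2 \<le> k" "k \<le> n + 1"
  shows "(\<forall>i < n + 1 - k. fps_nth (formal_P H k - formal_P K k) i = 0) \<and>
    (\<exists>c. c \<noteq> 0 \<and> fps_nth (formal_P H k - formal_P K k) (n + 1 - k) = c * fps_nth (H - K) n)"
  using assms(5,6)
proof (induction k rule: nat_induct_at_least)
  case base
  let ?D = "H - K" and ?d = "fps_nth (H - K) n"
  have D: "i < n \<Longrightarrow> fps_nth ?D i = 0" for i by (simp add: agree)
  have D': "i < n - 1 \<Longrightarrow> fps_nth (fps_deriv ?D) i = 0" for i using D by (simp add: agree)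
  have D'n: "fps_nth (fps_deriv ?D) (n - 1) = real n * ?d" using \<open>n \<ge> 1\<close> by (simp add: right_diff_distrib)
  let ?E = "formal_P H 1 - formal_P K 1"
  have E: "?E = ?D - fps_X * fps_deriv ?D"
    by (simp add: algebra_simps)
  have En: "fps_nth ?E n = (1 - real n) * ?d"
    unfolding E using \<open>n \<ge> 1\<close> by (simp add: algebra_simps)
  have E0: "i < n \<Longrightarrow> fps_nth ?E i = 0" for i
    unfolding E using D by simp
  have E': "i < n - 1 \<Longrightarrow> fps_nth (fps_deriv ?E) i = 0" for i using E0[of "i + 1"]
    by (simp only: fps_deriv_nth less_diff_conv mult_zero_right)
  have E'n: "fps_nth (fps_deriv ?E) (n - 1) = real n * (1 - real n) * ?d"
    using En \<open>n \<ge> 1\<close> by (simp only: fps_deriv_nth) (simp add: algebra_simps)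
  have P1: "fps_nth (formal_P K 1) 0 = 1" using assms by simp
  have *: "formal_P H 2 - formal_P K 2 = fps_deriv ?E * (1 + H) + ?D * fps_deriv (formal_P K 1)
      - fps_const 3 * (?E * fps_deriv H + fps_deriv ?D * formal_P K 1)"
    using formal_P_diff_step[of H 1 K] by (simp add: numeral_2_eq_2)
  have lo: "i < n - 1 \<Longrightarrow> fps_nth (formal_P H 2 - formal_P K 2) i = 0" for i
    unfolding * fps_sub_nth fps_add_nth fps_mult_left_const_nth
    using fps_nth_mult_lowest(2)[where a="n-1" and A="fps_deriv ?E", OF E']
      fps_nth_mult_lowest(2)[where a=n and A="?D", OF D]
      fps_nth_mult_lowest(2)[where a=n and A="?E", OF E0]
      fps_nth_mult_lowest(2)[where a="n-1" and A="fps_deriv ?D", OF D']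
    by simp
  have hi: "fps_nth (formal_P H 2 - formal_P K 2) (n - 1) =
      real n * (1 - real n) * ?d - 3 * (real n * ?d)"
    unfolding * fps_sub_nth fps_add_nth fps_mult_left_const_nth
    using fps_nth_mult_lowest(1)[where a="n-1" and A="fps_deriv ?E", OF E', unfolded E'n]
      fps_nth_mult_lowest(2)[where a=n and A="?D", OF D]
      fps_nth_mult_lowest(2)[where a=n and A="?E", OF E0]
      fps_nth_mult_lowest(1)[where a="n-1" and A="fps_deriv ?D", OF D', unfolded D'n P1]
      \<open>n \<ge> 1\<close> assms(1,2)
    by simp
  have "real n * (1 - real n) - 3 * real n = - (real n * (real n + 2))"
    by (simp add: algebra_simps)
  hence "fps_nth (formal_P H 2 - formal_P K 2) (n - 1) = (- (real n * (real n + 2))) * ?d"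
    using hi by (metis (no_types) left_diff_distrib mult.assoc)
  moreover have "- (real n * (real n + 2)) \<noteq> 0" using \<open>n \<ge> 1\<close> by auto
  ultimately have "\<exists>c. c \<noteq> 0 \<and> fps_nth (formal_P H 2 - formal_P K 2) (n - 1) = c * ?d" by blast
  moreover have "n + 1 - 2 = n - 1" by simp
  ultimately show ?case using lo by metis
next
  case (Suc k)
  let ?E = "formal_P H k - formal_P K k" and ?m = "n + 1 - Suc k"
  have m: "n + 1 - k = Suc ?m" using Suc by simp
  from Suc obtain c where "c \<noteq> 0" and c: "fps_nth ?E (Suc ?m) = c * fps_nth (H - K) n"
    and E0: "\<And>i. i < Suc ?m \<Longrightarrow> fps_nth ?E i = 0" unfolding m[symmetric] by auto
  have D: "i < n \<Longrightarrow> fps_nth (H - K) i = 0" for i by (simp add: agree)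
  have D': "i < n - 1 \<Longrightarrow> fps_nth (fps_deriv (H - K)) i = 0" for i using D by (simp add: agree)
  have E': "i < ?m \<Longrightarrow> fps_nth (fps_deriv ?E) i = 0" for i using E0[of "i + 1"]
    by (simp only: fps_deriv_nth less_diff_conv mult_zero_right)
  have E'n: "fps_nth (fps_deriv ?E) ?m = real (Suc ?m) * c * fps_nth (H - K) n"
    unfolding fps_deriv_nth Suc_eq_plus1[of ?m, symmetric] c by (simp only: mult.assoc)
  have lt: "?m < n - 1" "?m < n" using Suc by auto
  have lo: "i < ?m \<Longrightarrow> fps_nth (formal_P H (Suc k) - formal_P K (Suc k)) i = 0" for i
    unfolding formal_P_diff_step fps_sub_nth[of "_ + _"] fps_add_nth fps_mult_left_const_nth
    using fps_nth_mult_lowest(2)[where a="?m" and A="fps_deriv ?E", OF E', of i "1 + H"]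
      fps_nth_mult_lowest(2)[where a=n and A="H - K", OF D, of i]
      fps_nth_mult_lowest(2)[where a="Suc ?m" and A="?E", OF E0, of i]
      fps_nth_mult_lowest(2)[where a="n-1" and A="fps_deriv (H - K)", OF D', of i] lt
    by simp
  have hi: "fps_nth (formal_P H (Suc k) - formal_P K (Suc k)) ?m
      = (real (Suc ?m) * c) * fps_nth (H - K) n"
    unfolding formal_P_diff_step fps_sub_nth[of "_ + _"] fps_add_nth[of "_ * _"]
      fps_mult_left_const_nth
    using fps_nth_mult_lowest(1)[where a="?m" and A="fps_deriv ?E" and B="1 + H", OF E', unfolded E'n]
      fps_nth_mult_lowest(2)[where a=n and A="H - K", OF D, of ?m]
      fps_nth_mult_lowest(2)[where a="Suc ?m" and A="?E", OF E0, of ?m]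
      fps_nth_mult_lowest(2)[where a="n-1" and A="fps_deriv (H - K)", OF D', of ?m] lt assms(1)
    by simp
  show ?case using lo hi \<open>c \<noteq> 0\<close> by (intro conjI exI[of _ "real (Suc ?m) * c"]) auto
qed

text \<open>At the first order \<open>n\<close> at which two series differ, the values at \<open>0\<close> of the terms of index
  \<open>n + 1\<close> differ as well.\<close>
lemma formal_P_determines:
  fixes H K :: "real fps"
  assumes "fps_nth H 0 = 0" "fps_nth K 0 = 0"
    and eq: "\<And>k. k \<le> M \<Longrightarrow> fps_nth (formal_P H k) 0 = fps_nth (formal_P K k) 0"
    and "n < M"
  shows "fps_nth H n = fps_nth K n"
  using \<open>n < M\<close>
proof (induction n rule: less_induct)
  case (less n)
  show ?case
  proof (cases "n = 0")
    case False
    have "\<exists>c. c \<noteq> 0 \<and> fps_nth (formal_P H (n+1) - formal_P K (n+1)) (n + 1 - (n+1))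
        = c * fps_nth (H - K) n"
      using formal_P_leading_difference[of H K n "n + 1"] less False assms(1,2) by auto
    moreover have "fps_nth (formal_P H (n+1) - formal_P K (n+1)) 0 = 0"
      using eq[of "n+1"] less by (simp del: formal_P.simps)
    ultimately show ?thesis by auto
  qed (use assms in auto)
qed

section \<open>Truncated recursions\<close>

lemma coeff_truncation:
  assumes "u has_fps_expansion U" "i \<le> n"
  shows "coeff (truncation n u) i = fps_nth U i"
  using assms(2) unfolding truncation_def
  by (simp add: coeff_sum fps_nth_eq_higher_deriv[OF assms(1)] sum.delta)

lemma fps_nth_mult_cong:
  fixes A A' B :: "real fps"
  assumes "\<And>j. j \<le> i \<Longrightarrow> fps_nth A j = fps_nth A' j"
  shows "fps_nth (A * B) i = fps_nth (A' * B) i"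
  unfolding fps_mult_nth using assms by (intro sum.cong) auto

text \<open>A coefficient of order \<open>i\<close> of one term involves only the coefficients of order at most
  \<open>i + 1\<close> of the previous term, the shift by one being due to the derivative. The truncation
  degree \<open>M - k\<close> decreases at the same rate.\<close>
lemma coeff_P_trunc:
  assumes h: "h has_fps_expansion H"
  shows "k \<le> M \<Longrightarrow> i \<le> M - k \<Longrightarrow> coeff (P_trunc h M k) i = fps_nth (formal_P H k) i"
proof (induction k arbitrary: i)
  case 0
  thus ?case using coeff_truncation[OF P_seq_has_fps_expansion[OF h, of 0]] by simp
next
  case (Suc k)
  let ?p = "P_trunc h M k"
  have ex: "(\<lambda>\<xi>. poly (pderiv ?p) \<xi> * (1 + h \<xi>) - (2 * real (Suc k) - 1) * poly ?p \<xi> * deriv h \<xi>)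
     has_fps_expansion (fps_deriv (fps_of_poly ?p) * (1 + H)
        - fps_const (2 * real (Suc k) - 1) * fps_of_poly ?p * fps_deriv H)"
    unfolding fps_of_poly_pderiv[symmetric]
    by (intro fps_expansion_intros has_fps_expansion_poly h)
  have "fps_nth (fps_deriv (fps_of_poly ?p) * (1 + H)) i
      = fps_nth (fps_deriv (formal_P H k) * (1 + H)) i"
    by (rule fps_nth_mult_cong) (use Suc in simp)
  moreover have "fps_nth (fps_of_poly ?p * fps_deriv H) i
      = fps_nth (formal_P H k * fps_deriv H) i"
    by (rule fps_nth_mult_cong) (use Suc in simp)
  ultimately show ?case
    using coeff_truncation[OF ex Suc.prems(2)] by (simp add: Let_def mult.assoc)
qed

lemma coeff_mult_cong:
  fixes p p' q :: "real poly"
  assumes "\<And>j. j \<le> i \<Longrightarrow> coeff p j = coeff p' j"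
  shows "coeff (p * q) i = coeff (p' * q) i"
  unfolding coeff_mult using assms by (intro sum.cong) auto

lemma coeff_Q_trunc:
  "k \<le> M \<Longrightarrow> i \<le> M - k \<Longrightarrow> coeff (Q_trunc Nf Df Ng Dg M k) i = coeff (Q_seq Nf Df Ng Dg k) i"
proof (induction k arbitrary: i)
  case 0
  thus ?case using coeff_truncation[OF has_fps_expansion_poly] by simp
next
  case (Suc k)
  let ?q = "Q_trunc Nf Df Ng Dg M k" and ?q' = "Q_seq Nf Df Ng Dg k"
  have 1: "coeff (?q * r) i = coeff (?q' * r) i" for r
    by (rule coeff_mult_cong) (use Suc in simp)
  have 2: "coeff (pderiv ?q * r) i = coeff (pderiv ?q' * r) i" for r
    by (rule coeff_mult_cong) (use Suc in \<open>simp add: coeff_pderiv\<close>)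
  show ?case
    using coeff_truncation[OF has_fps_expansion_poly Suc.prems(2)] 
    by (simp add: Q_step_def mult.assoc 1 2)
qed

section \<open>Urabe coordinates\<close>

text \<open>The local coordinates in which the orbits become circles: \<open>F\<close> is a primitive of \<open>f\<close>, the
  functions \<open>X\<close> and \<open>\<xi>\<close> are mutually inverse, and \<open>1 + h\<close> is the derivative of \<open>u = \<integral> e\<^sup>F dx\<close> with
  respect to \<open>\<xi>\<close>. The last assumption is the equation \<open>\<xi> d\<xi> = G du\<close> with \<open>G = g e\<^sup>F\<close>, divided by
  \<open>d\<xi>\<close>.\<close>
locale urabe_coordinates =
  fixes f g F X \<xi> h :: "real \<Rightarrow> real" and a \<rho> :: real
  assumes a_pos: "a > 0" and rho_pos: "\<rho> > 0"
    and F_deriv: "\<bar>x\<bar> < a \<Longrightarrow> (F has_real_derivative f x) (at x)"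
    and X_mem: "\<bar>s\<bar> < \<rho> \<Longrightarrow> \<bar>X s\<bar> < a"
    and xi_X: "\<bar>s\<bar> < \<rho> \<Longrightarrow> \<xi> (X s) = s"
    and X_xi: "\<bar>x\<bar> < a \<Longrightarrow> X (\<xi> x) = x"
    and X_0: "X 0 = 0"
    and X_deriv: "\<bar>s\<bar> < \<rho> \<Longrightarrow> (X has_real_derivative (1 + h s) * exp (- F (X s))) (at s)"
    and xi_cont: "\<bar>x\<bar> < a \<Longrightarrow> isCont \<xi> x"
    and xi_deriv: "\<bar>x\<bar> < a \<Longrightarrow> \<bar>\<xi> x\<bar> < \<rho> \<Longrightarrow>
      (\<xi> has_real_derivative exp (F x) / (1 + h (\<xi> x))) (at x)"
    and h_pos: "\<bar>s\<bar> < \<rho> \<Longrightarrow> 1 + h s > 0"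
    and h_deriv: "\<bar>s\<bar> < \<rho> \<Longrightarrow> (h has_real_derivative deriv h s) (at s)"
    and h_0: "h 0 = 0"
    and force: "\<bar>s\<bar> < \<rho> \<Longrightarrow> g (X s) * exp (F (X s)) * (1 + h s) = s"

text \<open>The potential \<open>W = \<integral> g e\<^sup>2\<^sup>F\<close> has the expansion \<open>x\<^sup>2 / 2 + \<dots>\<close>, so \<open>2 W = x\<^sup>2 w\<close> with \<open>w\<close>
  analytic and \<open>w(0) = 1\<close>. Therefore \<open>\<xi> = x \<surd>w\<close> is analytic with \<open>\<xi>'(0) = 1\<close> and has an analytic
  inverse \<open>X\<close>, and \<open>1 + h\<close> can be taken to be \<open>X' e\<^sup>F\<close>, evaluated along \<open>X\<close>. The predicate \<open>Q\<close> stands for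
  any further property that is wanted near \<open>0\<close>.\<close>
lemma urabe_coordinates_exist:
  fixes f g :: "real \<Rightarrow> real"
  assumes f: "f has_fps_expansion Ff" and g: "g has_fps_expansion Gf"
    and "g 0 = 0" and g': "(g has_real_derivative 1) (at 0)"
    and good: "\<forall>\<^sub>F x in nhds 0. Q x"
  obtains F X \<xi> h a \<rho> H where "urabe_coordinates f g F X \<xi> h a \<rho>"
    and "h has_fps_expansion H" and "F 0 = 0" and "\<And>x. \<bar>x\<bar> < a \<Longrightarrow> Q x"
proof -
  obtain F FF where F: "F has_fps_expansion FF" and F0: "F 0 = 0"
    and F': "\<forall>\<^sub>F x in nhds 0. (F has_field_derivative f x) (at x)"
    by (rule has_fps_expansion_primitive[OF f])
  define k where "k = (\<lambda>x. g x * exp (2 * F x))"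
  obtain E where E: "(\<lambda>x. exp (2 * F x)) has_fps_expansion E"
    using has_fps_expansion_exp_compose[OF has_fps_expansion_cmult_left[OF F, of 2]] by auto
  have k: "k has_fps_expansion Gf * E"
    unfolding k_def by (intro fps_expansion_intros g E)
  have k0: "k 0 = 0" using \<open>g 0 = 0\<close> by (simp add: k_def)
  have F'0: "(F has_real_derivative f 0) (at 0)" using eventually_nhds_x_imp_x[OF F'] .
  have k': "(k has_real_derivative 1) (at 0)"
    unfolding k_def by (rule derivative_eq_intros g' F'0 refl)+ (simp add: F0 \<open>g 0 = 0\<close>)
  obtain W WW where W: "W has_fps_expansion WW" and W0: "W 0 = 0"
    and W': "\<forall>\<^sub>F x in nhds 0. (W has_field_derivative k x) (at x)"
    by (rule has_fps_expansion_primitive[OF k])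
  have kW: "k has_fps_expansion fps_deriv WW"
  proof -
    have "\<forall>\<^sub>F x in nhds 0. deriv W x = k x"
      using W' by eventually_elim (rule DERIV_imp_deriv)
    thus ?thesis using has_fps_expansion_deriv[OF W] has_fps_expansion_cong by blast
  qed
  have WW0: "fps_nth WW 0 = 0" using has_fps_expansion_at_0[OF W] W0 by simp
  have WW1: "fps_nth WW 1 = 0" using has_fps_expansion_at_0[OF kW] k0 by simp
  \<comment> \<open>The hypothesis \<open>g'(0) = 1\<close> enters here: it gives \<open>W''(0) = 1\<close>.\<close>
  have WW2: "fps_nth WW 2 = 1 / 2"
    using fps_nth_1_eq_deriv[OF kW k'] by (simp add: numeral_2_eq_2)
  define w where "w = (\<lambda>x. if x = 0 then 1 else 2 * W x / x ^ 2)"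
  have "subdegree (fps_const 2 * WW) \<ge> 2"
    using WW0 WW1 WW2 by (intro subdegree_geI) (auto simp: less_2_cases_iff fps_eq_iff intro!: exI[of _ 2])
  hence w: "w has_fps_expansion fps_shift 2 (fps_const 2 * WW)"
    unfolding w_def by (intro fps_expansion_intros W) (simp_all add: WW2)
  have w0: "w 0 = 1" by (simp add: w_def)
  have w2: "x ^ 2 * w x = 2 * W x" for x by (simp add: w_def W0)
  obtain R where R: "(\<lambda>x. sqrt (w x)) has_fps_expansion R"
    using has_fps_expansion_sqrt_compose[OF w] w0 by auto
  define \<xi> where "\<xi> = (\<lambda>x. x * sqrt (w x))"
  have xi: "\<xi> has_fps_expansion fps_X * R"
    unfolding \<xi>_def by (intro fps_expansion_intros R)
  have R0: "fps_nth R 0 = 1" using has_fps_expansion_at_0[OF R] w0 by simp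
  obtain X XX where X: "X has_fps_expansion XX" and Xxi: "\<forall>\<^sub>F x in nhds 0. X (\<xi> x) = x"
    using has_fps_expansion_local_inverse[OF xi] R0 by auto
  have xi0: "\<xi> 0 = 0" by (simp add: \<xi>_def)
  have X0: "X 0 = 0" using eventually_nhds_x_imp_x[OF Xxi] by (simp add: xi0)
  obtain FX where FX: "(\<lambda>s. F (X s)) has_fps_expansion FX"
    using has_fps_expansion_compose_real[OF F X X0] by auto
  obtain EE where EE: "(\<lambda>s. exp (F (X s))) has_fps_expansion EE"
    using has_fps_expansion_exp_compose[OF FX] by auto
  define h where "h = (\<lambda>s. deriv X s * exp (F (X s)) - 1)"
  have h: "h has_fps_expansion fps_deriv XX * EE - 1"
    unfolding h_def by (intro fps_expansion_intros X EE)
  have xi': "(\<xi> has_real_derivative 1) (at 0)"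
    using eventually_nhds_x_imp_x[OF has_fps_expansion_imp_differentiable[OF xi]]
      has_fps_expansion_at_0[OF has_fps_expansion_deriv[OF xi]] R0 by simp
  have chain: "deriv X (\<xi> x) * d = 1"
    if "(X has_real_derivative deriv X (\<xi> x)) (at (\<xi> x))" "(\<xi> has_real_derivative d) (at x)"
      "\<forall>\<^sub>F y in nhds x. X (\<xi> y) = y" for x d
  proof -
    have "((\<lambda>y. X (\<xi> y)) has_real_derivative deriv X (\<xi> x) * d) (at x)"
      by (rule DERIV_chain2[OF that(1,2)])
    moreover have "((\<lambda>y. X (\<xi> y)) has_real_derivative 1) (at x)"
      using DERIV_cong_ev[OF refl that(3) refl] by (metis DERIV_ident)
    ultimately show ?thesis by (rule DERIV_unique)
  qed
  have dX: "\<forall>\<^sub>F s in nhds 0. (X has_real_derivative deriv X s) (at s)"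
    by (rule has_fps_expansion_imp_differentiable[OF X])
  have "deriv X 0 = 1"
    using chain[of 0 1] eventually_nhds_x_imp_x[OF dX] xi' Xxi xi0 by simp
  hence h0: "h 0 = 0" by (simp add: h_def X0 F0)
  have tend: "filterlim u (nhds (u 0)) (nhds 0)" if "u has_fps_expansion U" for u :: "real \<Rightarrow> real" and U
    using has_fps_expansion_imp_continuous[OF that, of UNIV]
    by (simp add: continuous_at tendsto_at_iff_tendsto_nhds)
  have "\<forall>\<^sub>F s in nhds 0. h s > -1" using tend[OF h] h0 by (intro order_tendstoD) auto
  with dX has_fps_expansion_imp_differentiable[OF h]
  have "\<forall>\<^sub>F s in nhds 0. (X has_real_derivative deriv X s) (at s) \<and>
      (h has_real_derivative deriv h s) (at s) \<and> h s > -1"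
    by eventually_elim auto
  then obtain r where "r > 0" and r: "\<And>s. \<bar>s\<bar> \<le> r \<Longrightarrow> (X has_real_derivative deriv X s) (at s)"
      "\<And>s. \<bar>s\<bar> \<le> r \<Longrightarrow> (h has_real_derivative deriv h s) (at s)" "\<And>s. \<bar>s\<bar> \<le> r \<Longrightarrow> h s > -1"
    by (rule eventually_nhds_0_interval) blast
  have "\<forall>\<^sub>F x in nhds 0. w x > 0" using tend[OF w] w0 by (intro order_tendstoD) auto
  moreover have "\<forall>\<^sub>F x in nhds 0. \<forall>\<^sub>F y in nhds x. X (\<xi> y) = y"
    using Xxi by (simp add: eventually_eventually)
  ultimately have "\<forall>\<^sub>F x in nhds 0. w x > 0 \<and> (\<forall>\<^sub>F y in nhds x. X (\<xi> y) = y) \<and>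
      (\<xi> has_real_derivative deriv \<xi> x) (at x) \<and> (F has_real_derivative f x) (at x) \<and>
      (W has_real_derivative k x) (at x) \<and> Q x"
    using has_fps_expansion_imp_differentiable[OF xi] F' W' good by eventually_elim auto
  then obtain a where "a > 0" and a: "\<And>x. \<bar>x\<bar> \<le> a \<Longrightarrow> w x > 0"
      "\<And>x. \<bar>x\<bar> \<le> a \<Longrightarrow> \<forall>\<^sub>F y in nhds x. X (\<xi> y) = y"
      "\<And>x. \<bar>x\<bar> \<le> a \<Longrightarrow> (\<xi> has_real_derivative deriv \<xi> x) (at x)"
      "\<And>x. \<bar>x\<bar> \<le> a \<Longrightarrow> (F has_real_derivative f x) (at x)"
      "\<And>x. \<bar>x\<bar> \<le> a \<Longrightarrow> (W has_real_derivative k x) (at x)"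
      "\<And>x. \<bar>x\<bar> \<le> a \<Longrightarrow> Q x"
    by (rule eventually_nhds_0_interval) blast
  have inv: "X (\<xi> x) = x" if "\<bar>x\<bar> \<le> a" for x
    using eventually_nhds_x_imp_x[OF a(2)[OF that]] .
  \<comment> \<open>The interval of radius \<open>\<rho>\<close> is covered by the values of \<open>\<xi>\<close> on \<open>(-a, a)\<close>, because
    \<open>\<xi>(-a) < 0 < \<xi>(a)\<close>.\<close>
  define \<rho> where "\<rho> = min r (min (\<xi> a) (- \<xi> (- a)))"
  have "\<rho> > 0"
    using \<open>r > 0\<close> \<open>a > 0\<close> a(1)[of a] a(1)[of "-a"] by (simp add: \<rho>_def \<xi>_def)
  have surj: "\<exists>x. \<bar>x\<bar> < a \<and> \<xi> x = s" if "\<bar>s\<bar> < \<rho>" for s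
  proof -
    have "\<exists>x\<ge>-a. x \<le> a \<and> \<xi> x = s"
      using that \<open>a > 0\<close> by (intro IVT) (auto simp: \<rho>_def intro!: DERIV_isCont[OF a(3)])
    then obtain x where "-a \<le> x" "x \<le> a" "\<xi> x = s" by blast
    moreover from this have "x \<noteq> a" "x \<noteq> -a" using that by (auto simp: \<rho>_def)
    ultimately show ?thesis by (intro exI[of _ x]) auto
  qed
  have sX: "\<bar>X s\<bar> < a \<and> \<xi> (X s) = s" if "\<bar>s\<bar> < \<rho>" for s
  proof -
    from surj[OF that] obtain x where "\<bar>x\<bar> < a" "\<xi> x = s" by blast
    moreover from this have "X s = x" using inv[of x] by auto
    ultimately show ?thesis by simp
  qed
  have X_deriv: "(X has_real_derivative (1 + h s) * exp (- F (X s))) (at s)" if "\<bar>s\<bar> < \<rho>" for s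
    using r(1)[of s] that by (simp add: \<rho>_def h_def exp_minus field_simps)
  have xi_deriv: "deriv \<xi> x = exp (F x) / (1 + h (\<xi> x))" if "\<bar>x\<bar> < a" "\<bar>\<xi> x\<bar> < \<rho>" for x
  proof -
    have "deriv X (\<xi> x) * deriv \<xi> x = 1"
      using that r(1)[of "\<xi> x"] a(2,3)[of x] by (intro chain) (auto simp: \<rho>_def)
    moreover from this have "deriv X (\<xi> x) \<noteq> 0" by auto
    ultimately show ?thesis using that inv[of x] by (simp add: h_def field_simps)
  qed
  have force: "g (X s) * exp (F (X s)) * (1 + h s) = s" if "\<bar>s\<bar> < \<rho>" for s
  proof -
    define x where "x = X s"
    have x: "\<bar>x\<bar> < a" "\<xi> x = s" using sX[OF that] by (auto simp: x_def)
    have "\<forall>\<^sub>F y in nhds x. y \<in> {-a<..<a}"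
      using x(1) by (intro eventually_nhds_in_open) auto
    \<comment> \<open>Differentiating \<open>\<xi>\<^sup>2 = 2 W\<close> at \<open>x\<close>.\<close>
    hence "\<forall>\<^sub>F y in nhds x. \<xi> y ^ 2 = 2 * W y"
    proof eventually_elim
      case (elim y)
      hence "w y > 0" using a(1)[of y] by auto
      thus ?case using w2[of y] by (simp add: \<xi>_def power_mult_distrib)
    qed
    moreover have "((\<lambda>y. \<xi> y ^ 2) has_real_derivative 2 * s * deriv \<xi> x) (at x)"
      using a(3)[of x] x by (auto intro!: derivative_eq_intros)
    moreover have "((\<lambda>y. 2 * W y) has_real_derivative 2 * k x) (at x)"
      using a(5)[of x] x by (auto intro!: derivative_eq_intros)
    ultimately have "2 * s * deriv \<xi> x = 2 * k x"
      using DERIV_cong_ev[OF refl _ refl] DERIV_unique by metis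
    hence "s * (exp (F x) / (1 + h s)) = g x * exp (2 * F x)"
      using xi_deriv[of x] x that by (simp add: k_def)
    moreover have "1 + h s > 0" using r(3)[of s] that by (simp add: \<rho>_def)
    moreover have "exp (2 * F x) = exp (F x) * exp (F x)" by (simp flip: exp_add)
    ultimately have "s * exp (F x) = (g x * exp (F x) * (1 + h s)) * exp (F x)"
      by (simp add: field_simps)
    thus ?thesis by (simp add: x_def)
  qed
  have "urabe_coordinates f g F X \<xi> h a \<rho>"
  proof
    show "(\<xi> has_real_derivative exp (F x) / (1 + h (\<xi> x))) (at x)"
      if "\<bar>x\<bar> < a" "\<bar>\<xi> x\<bar> < \<rho>" for x
      using a(3)[of x] xi_deriv[OF that] that by simp
    show "isCont \<xi> x" if "\<bar>x\<bar> < a" for x using a(3)[of x] that by (auto intro: DERIV_isCont)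
    show "1 + h s > 0" "(h has_real_derivative deriv h s) (at s)" if "\<bar>s\<bar> < \<rho>" for s
      using r(2,3)[of s] that by (auto simp: \<rho>_def)
  qed (use \<open>a > 0\<close> \<open>\<rho> > 0\<close> a(4) sX inv X0 X_deriv h0 force in auto)
  thus ?thesis using that h F0 a(6) by (metis less_imp_le)
qed

text \<open>Both sides, divided by \<open>(1 + h)\<^sup>2\<^sup>k\<^sup>+\<^sup>1\<close>, are the \<open>k\<close>-th derivative of \<open>G = g e\<^sup>F\<close> with respect to
  \<open>u\<close>: on the left \<open>d/du = (1 + h)\<^sup>-\<^sup>1 d/d\<xi>\<close>, on the right \<open>d/du = e\<^sup>-\<^sup>F d/dx\<close>. The equation
  \<open>dx/d\<xi> = (1 + h) e\<^sup>-\<^sup>F\<close> says that the two operators agree.\<close>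
lemma (in urabe_coordinates) P_seq_eq_Q_seq:
  assumes "f = (\<lambda>x. poly Nf x / poly Df x)" and "g = (\<lambda>x. poly Ng x / poly Dg x)"
    and nz: "\<And>x. \<bar>x\<bar> < a \<Longrightarrow> poly Df x \<noteq> 0 \<and> poly Dg x \<noteq> 0"
    and "\<bar>s\<bar> < \<rho>"
  shows "P_seq h k s = poly (Q_seq Nf Df Ng Dg k) (X s) * exp ((1 - real k) * F (X s))
     / (poly Dg (X s) ^ (k + 1) * poly Df (X s) ^ k) * (1 + h s) ^ (2 * k + 1)"
  using \<open>\<bar>s\<bar> < \<rho>\<close>
proof (induction k arbitrary: s)
  case 0
  show ?case using force[OF 0] by (simp add: assms(2))
next
  case (Suc k)
  let ?q = "Q_seq Nf Df Ng Dg k" and ?x = "X s"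
  define A where "A = (\<lambda>x. poly ?q x * exp ((1 - real k) * F x) / (poly Dg x ^ (k + 1) * poly Df x ^ k))"
  define A' where "A' = poly (Q_seq Nf Df Ng Dg (Suc k)) ?x * exp ((1 - real k) * F ?x)
      / (poly Dg ?x ^ (k + 2) * poly Df ?x ^ (k + 1))"
  have x: "\<bar>?x\<bar> < a" using X_mem[OF Suc.prems] .
  have nzx: "poly Df ?x \<noteq> 0" "poly Dg ?x \<noteq> 0" using nz[OF x] by auto
  have dA: "(A has_real_derivative A') (at ?x)"
  proof -
    define D where "D = poly Dg ?x ^ (k + 1) * poly Df ?x ^ k"
    define D' where "D' = real (k + 1) * poly Dg ?x ^ k * poly (pderiv Dg) ?x * poly Df ?x ^ k
      + poly Dg ?x ^ (k + 1) * (real k * poly Df ?x ^ (k - 1) * poly (pderiv Df) ?x)"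
    define e where "e = exp ((1 - real k) * F ?x)"
    have dD: "((\<lambda>x. poly Dg x ^ (k + 1) * poly Df x ^ k) has_real_derivative D') (at ?x)"
      unfolding D'_def
      by (rule derivative_eq_intros poly_DERIV refl)+ (simp add: algebra_simps)
    have dN: "((\<lambda>x. poly ?q x * exp ((1 - real k) * F x)) has_real_derivative
        (poly (pderiv ?q) ?x + poly ?q ?x * ((1 - real k) * f ?x)) * e) (at ?x)"
      unfolding e_def
      by (rule derivative_eq_intros poly_DERIV refl F_deriv x)+ (simp add: algebra_simps)
    have "D \<noteq> 0" using nzx by (simp add: D_def)
    have "(A has_real_derivative ((poly (pderiv ?q) ?x + poly ?q ?x * ((1 - real k) * f ?x)) * e * D
         - poly ?q ?x * e * D') / (D * D)) (at ?x)"
      unfolding A_def using DERIV_divide[OF dN dD] \<open>D \<noteq> 0\<close> by (simp add: D_def e_def)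
    moreover have "((poly (pderiv ?q) ?x + poly ?q ?x * ((1 - real k) * f ?x)) * e * D
         - poly ?q ?x * e * D') / (D * D) = A'"
    proof -
      have D'': "D' * (poly Dg ?x * poly Df ?x) = D * (real (k + 1) * poly (pderiv Dg) ?x * poly Df ?x
          + real k * poly (pderiv Df) ?x * poly Dg ?x)"
        by (cases k) (simp_all add: D_def D'_def algebra_simps)
      have 1: "A' = poly (Q_seq Nf Df Ng Dg (Suc k)) ?x * e / (D * (poly Dg ?x * poly Df ?x))"
        by (simp add: A'_def e_def D_def field_simps)
      have 2: "poly (Q_seq Nf Df Ng Dg (Suc k)) ?x =
          (poly (pderiv ?q) ?x + poly ?q ?x * ((1 - real k) * f ?x)) * (poly Dg ?x * poly Df ?x)
          - poly ?q ?x * (real (k + 1) * poly (pderiv Dg) ?x * poly Df ?x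
          + real k * poly (pderiv Df) ?x * poly Dg ?x)"
        using nzx by (simp add: Q_step_def assms(1) field_simps)
      have 3: "((poly (pderiv ?q) ?x + poly ?q ?x * ((1 - real k) * f ?x)) * e * D
         - poly ?q ?x * e * D') * (poly Dg ?x * poly Df ?x) =
         poly (Q_seq Nf Df Ng Dg (Suc k)) ?x * e * D"
      proof -
        have split: "(N * e * D - q * e * D') * G = N * G * (e * D) - q * e * (D' * G)" for N q G
          by (simp add: algebra_simps)
        show ?thesis unfolding 2 split D'' by (simp add: algebra_simps)
      qed
      show ?thesis unfolding 1 using 3 \<open>D \<noteq> 0\<close> nzx by (simp add: frac_eq_eq field_simps)
    qed
    ultimately show ?thesis by simp
  qed
  define u where "u = 1 + h s"
  have "u > 0" using h_pos[OF Suc.prems] by (simp add: u_def)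
  have dAX: "((\<lambda>s. A (X s)) has_real_derivative A' * (u * exp (- F ?x))) (at s)"
    using DERIV_chain2[OF dA X_deriv[OF Suc.prems]] by (simp add: u_def)
  have dPow: "((\<lambda>s. (1 + h s) ^ (2 * k + 1)) has_real_derivative
      real (2 * k + 1) * u ^ (2 * k) * deriv h s) (at s)"
    unfolding u_def by (rule derivative_eq_intros h_deriv Suc.prems refl)+ simp
  have IH: "P_seq h k t = A (X t) * (1 + h t) ^ (2 * k + 1)" if "\<bar>t\<bar> < \<rho>" for t
    using Suc.IH[OF that] by (simp add: A_def)
  have "\<forall>\<^sub>F t in nhds s. t \<in> {-\<rho><..<\<rho>}"
    using Suc.prems by (intro eventually_nhds_in_open) auto
  hence "\<forall>\<^sub>F t in nhds s. P_seq h k t = A (X t) * (1 + h t) ^ (2 * k + 1)"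
    by eventually_elim (rule IH, auto)
  hence "deriv (P_seq h k) s = deriv (\<lambda>t. A (X t) * (1 + h t) ^ (2 * k + 1)) s"
    by (intro deriv_cong_ev) auto
  also have "\<dots> = A' * (u * exp (- F ?x)) * u ^ (2 * k + 1)
      + real (2 * k + 1) * u ^ (2 * k) * deriv h s * A ?x"
    using DERIV_imp_deriv[OF DERIV_mult[OF dAX dPow]] by (simp add: u_def)
  finally have d: "deriv (P_seq h k) s = \<dots>" .
  have "P_seq h (Suc k) s = deriv (P_seq h k) s * u - real (2 * k + 1) * (A ?x * u ^ (2 * k + 1)) * deriv h s"
    using IH[OF Suc.prems] by (simp add: Let_def u_def)
  also have "\<dots> = A' * exp (- F ?x) * u ^ (2 * Suc k + 1)"
    unfolding d by (simp add: algebra_simps)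
  also have "A' * exp (- F ?x) = poly (Q_seq Nf Df Ng Dg (Suc k)) ?x * 
      (exp ((1 - real k) * F ?x) * exp (- F ?x)) / (poly Dg ?x ^ (k + 2) * poly Df ?x ^ (k + 1))"
    by (simp add: A'_def)
  also have "exp ((1 - real k) * F ?x) * exp (- F ?x) = exp ((1 - real (Suc k)) * F ?x)"
    by (simp add: algebra_simps flip: exp_add)
  finally show ?case by (simp add: u_def)
qed

section \<open>Orbits in Urabe coordinates\<close>

lemma polar_point:
  fixes s v :: real
  assumes "s\<^sup>2 + v\<^sup>2 = r\<^sup>2" "r > 0"
  obtains \<theta> where "s = r * sin \<theta>" "v = r * cos \<theta>"
proof -
  have "(v / r)\<^sup>2 + (s / r)\<^sup>2 = 1" using assms by (simp add: power_divide add.commute flip: add_divide_distrib)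
  then obtain \<theta> where "v / r = cos \<theta>" "s / r = sin \<theta>" by (metis sincos_total_2pi)
  thus ?thesis using that[of \<theta>] \<open>r > 0\<close> by (simp add: field_simps)
qed

context urabe_coordinates
begin

text \<open>The inverse of the coordinate map \<open>(x, y) \<mapsto> (\<xi>(x), y e\<^sup>F\<^sup>(\<^sup>x\<^sup>))\<close>.\<close>
definition chart :: "real \<times> real \<Rightarrow> plane" where
  "chart = (\<lambda>(s, v). (X s, v * exp (- F (X s))))"

definition disc :: "real \<Rightarrow> plane set" where
  "disc r = {(x, y). \<bar>x\<bar> < a \<and> (\<xi> x)\<^sup>2 + (y * exp (F x))\<^sup>2 < r\<^sup>2}"

text \<open>The time as a function of the polar angle along the circle of radius \<open>r\<close>, normalized only up
  to an additive constant. It is its increments that matter.\<close>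
definition time_fn :: "real \<Rightarrow> real \<Rightarrow> real" where
  "time_fn r = (SOME \<tau>. \<forall>\<theta>. (\<tau> has_real_derivative 1 + h (r * sin \<theta>)) (at \<theta>))"

definition period :: "real \<Rightarrow> real" where
  "period r = time_fn r pi - time_fn r (- pi)"

definition angle :: "real \<Rightarrow> real \<Rightarrow> real" where
  "angle r = inv (time_fn r)"

definition orbit :: "real \<Rightarrow> real \<Rightarrow> plane" where
  "orbit r t = chart (r * sin (angle r t), r * cos (angle r t))"

lemma abs_less_of_sum_squares:
  fixes s v :: real
  assumes "s\<^sup>2 + v\<^sup>2 \<le> r\<^sup>2" "0 < r" "r < \<rho>"
  shows "\<bar>s\<bar> < \<rho>"
proof -
  have "s\<^sup>2 \<le> r\<^sup>2" using assms(1) by (smt (verit) zero_le_power2)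
  hence "\<bar>s\<bar> \<le> r" using assms(2) abs_le_square_iff[of s r] by simp
  thus ?thesis using assms by simp
qed

lemma abs_sin_less:
  assumes "0 < r" "r < \<rho>"
  shows "\<bar>r * sin \<theta>\<bar> < \<rho>"
proof -
  have "\<bar>r * sin \<theta>\<bar> \<le> r * 1"
    unfolding abs_mult using assms by (intro mult_mono) auto
  thus ?thesis using assms by simp
qed

lemma time_fn_deriv:
  assumes "0 < r" "r < \<rho>"
  shows "(time_fn r has_real_derivative 1 + h (r * sin \<theta>)) (at \<theta>)"
proof -
  have "isCont (\<lambda>\<theta>. 1 + h (r * sin \<theta>)) \<theta>" for \<theta>
  proof -
    have "isCont (\<lambda>\<theta>. r * sin \<theta>) \<theta>" by (intro continuous_intros)
    from isCont_o2[OF this DERIV_isCont[OF h_deriv[OF abs_sin_less[OF assms]]]]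
    show ?thesis by (intro continuous_intros)
  qed
  hence "\<exists>\<tau>. \<forall>\<theta>::real. -\<infinity> < ereal \<theta> \<longrightarrow> ereal \<theta> < \<infinity> \<longrightarrow>
      (\<tau> has_vector_derivative (1 + h (r * sin \<theta>))) (at \<theta>)"
    by (intro einterval_antiderivative) auto
  hence "\<exists>\<tau>. \<forall>\<theta>. (\<tau> has_real_derivative 1 + h (r * sin \<theta>)) (at \<theta>)"
    by (simp add: has_real_derivative_iff_has_vector_derivative)
  from someI_ex[OF this] show ?thesis unfolding time_fn_def by blast
qed

lemma time_fn_strict_mono:
  assumes "0 < r" "r < \<rho>"
  shows "strict_mono (time_fn r)"
proof (rule strict_monoI)
  fix x y :: real assume "x < y"
  thus "time_fn r x < time_fn r y"
  proof (rule DERIV_pos_imp_increasing)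
    show "\<exists>d. (time_fn r has_real_derivative d) (at z) \<and> d > 0" for z
      using time_fn_deriv[OF assms, of z] h_pos[OF abs_sin_less[OF assms, of z]] by blast
  qed
qed

text \<open>The density \<open>1 + h(r sin \<theta>)\<close> has period \<open>2 \<pi>\<close>, so every full turn takes the same time.\<close>
lemma time_fn_add_2pi:
  assumes "0 < r" "r < \<rho>"
  shows "time_fn r (\<theta> + 2 * pi) = time_fn r \<theta> + period r"
proof -
  define D where "D = (\<lambda>\<theta>. time_fn r (\<theta> + 2 * pi) - time_fn r \<theta>)"
  have "(D has_real_derivative 0) (at \<theta>)" for \<theta>
  proof -
    have "((\<lambda>\<theta>. time_fn r (\<theta> + 2 * pi)) has_real_derivative
        (1 + h (r * sin (\<theta> + 2 * pi))) * 1) (at \<theta>)"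
      by (rule DERIV_chain2[OF time_fn_deriv[OF assms]]) (auto intro!: derivative_eq_intros)
    from DERIV_diff[OF this time_fn_deriv[OF assms, of \<theta>]] show ?thesis
      unfolding D_def by simp
  qed
  hence "D \<theta> = D (- pi)" by (intro DERIV_isconst_all) auto
  thus ?thesis by (simp add: D_def period_def)
qed

lemma period_pos:
  assumes "0 < r" "r < \<rho>"
  shows "period r > 0"
  using strict_monoD[OF time_fn_strict_mono[OF assms], of "-pi" pi] by (simp add: period_def)

lemma bij_time_fn:
  assumes "0 < r" "r < \<rho>"
  shows "bij (time_fn r)"
proof (rule bijI)
  show "inj (time_fn r)" using time_fn_strict_mono[OF assms] by (rule strict_mono_imp_inj_on)
  have turns: "time_fn r (real n * (2 * pi) + c) = real n * period r + time_fn r c" for n c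
  proof (induction n)
    case (Suc n)
    have "time_fn r (real (Suc n) * (2 * pi) + c) = time_fn r ((real n * (2 * pi) + c) + 2 * pi)"
      by (simp add: algebra_simps)
    also have "\<dots> = real (Suc n) * period r + time_fn r c"
      unfolding time_fn_add_2pi[OF assms] Suc by (simp add: algebra_simps)
    finally show ?case .
  qed simp
  show "surj (time_fn r)"
    unfolding surj_def
  proof
    fix t
    \<comment> \<open>Sufficiently many turns in either direction pass any prescribed time \<open>t\<close>.\<close>
    obtain n :: nat where n: "\<bar>t - time_fn r 0\<bar> < real n * period r"
      using reals_Archimedean3[OF period_pos[OF assms]] by blast
    have "\<exists>\<theta>\<ge>- (real n * (2 * pi)). \<theta> \<le> real n * (2 * pi) \<and> time_fn r \<theta> = t"
      using n turns[of n 0] turns[of n "- (real n * (2 * pi))"]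
      by (intro IVT) (auto intro!: DERIV_isCont[OF time_fn_deriv[OF assms]])
    thus "\<exists>\<theta>. t = time_fn r \<theta>" by blast
  qed
qed

lemma
  assumes "0 < r" "r < \<rho>"
  shows time_fn_angle: "time_fn r (angle r t) = t"
    and angle_time_fn: "angle r (time_fn r \<theta>) = \<theta>"
  unfolding angle_def using bij_time_fn[OF assms]
  by (simp_all add: bij_is_surj surj_f_inv_f bij_is_inj)

lemma angle_deriv:
  assumes "0 < r" "r < \<rho>"
  shows "(angle r has_real_derivative 1 / (1 + h (r * sin (angle r t)))) (at t)"
proof -
  have "isCont (angle r) (time_fn r (angle r t))"
    by (rule isCont_inverse_function[of 1])
      (auto simp: angle_time_fn[OF assms] intro: DERIV_isCont[OF time_fn_deriv[OF assms]])
  hence cont: "isCont (angle r) t" by (simp add: time_fn_angle[OF assms])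
  have "1 + h (r * sin (angle r t)) \<noteq> 0" 
    using h_pos[OF abs_sin_less[OF assms, of "angle r t"]] by simp
  from DERIV_inverse_function[where f = "time_fn r" and g = "angle r" and x = t and a = "t - 1"
      and b = "t + 1", OF time_fn_deriv[OF assms] this] cont
  show ?thesis by (simp add: time_fn_angle[OF assms] inverse_eq_divide)
qed

lemma angle_add_period:
  assumes "0 < r" "r < \<rho>"
  shows "angle r (t + period r) = angle r t + 2 * pi"
  using angle_time_fn[OF assms, of "angle r t + 2 * pi"]
  by (simp add: time_fn_add_2pi[OF assms] time_fn_angle[OF assms])

lemma chart_inverse:
  assumes "\<bar>s\<bar> < \<rho>"
  shows "\<xi> (fst (chart (s, v))) = s" "snd (chart (s, v)) * exp (F (fst (chart (s, v)))) = v"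
    "\<bar>fst (chart (s, v))\<bar> < a"
  using xi_X[OF assms] X_mem[OF assms] by (simp_all add: chart_def flip: exp_add)

lemma chart_inj:
  assumes "\<bar>s\<bar> < \<rho>" "\<bar>s'\<bar> < \<rho>" "chart (s, v) = chart (s', v')"
  shows "s = s'" "v = v'"
  using chart_inverse[OF assms(1), of v] chart_inverse[OF assms(2), of v'] assms(3) by simp_all

lemma chart_surj:
  assumes "\<bar>x\<bar> < a"
  shows "chart (\<xi> x, y * exp (F x)) = (x, y)"
  using X_xi[OF assms] by (simp add: chart_def flip: exp_add)

lemma chart_0: "chart (0, 0) = (0, 0)"
  by (simp add: chart_def X_0)

lemma chart_mem_disc:
  assumes "\<bar>s\<bar> < \<rho>"
  shows "chart (s, v) \<in> disc r \<longleftrightarrow> s\<^sup>2 + v\<^sup>2 < r\<^sup>2"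
  using chart_inverse[OF assms, of v] by (auto simp: disc_def split: prod.splits)

lemma disc_chartE:
  assumes "q \<in> disc r" "0 < r" "r \<le> \<rho>"
  obtains s v where "q = chart (s, v)" "s\<^sup>2 + v\<^sup>2 < r\<^sup>2" "\<bar>s\<bar> < \<rho>"
proof -
  obtain x y where q: "q = (x, y)" and x: "\<bar>x\<bar> < a" "(\<xi> x)\<^sup>2 + (y * exp (F x))\<^sup>2 < r\<^sup>2"
    using assms(1) by (auto simp: disc_def)
  have "(\<xi> x)\<^sup>2 < r\<^sup>2" using x(2) by (smt (verit) zero_le_power2)
  hence "\<bar>\<xi> x\<bar> < r" using assms(2) power2_less_imp_less[of "\<bar>\<xi> x\<bar>" r] by simp
  with that[of "\<xi> x" "y * exp (F x)"] x q chart_surj[OF x(1)] assms(3) show ?thesis by simp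
qed

lemma isCont_F: "\<bar>x\<bar> < a \<Longrightarrow> isCont F x"
  by (rule DERIV_isCont[OF F_deriv])

lemma isCont_chart:
  assumes "\<bar>fst z\<bar> < \<rho>"
  shows "isCont chart z"
proof -
  have "isCont X (fst z)" using DERIV_isCont[OF X_deriv[OF assms]] .
  moreover have "isCont fst z" by (intro continuous_intros)
  ultimately have "isCont (\<lambda>z. X (fst z)) z" by (rule isCont_o2[rotated])
  moreover from this have "isCont (\<lambda>z. F (X (fst z))) z"
    by (rule isCont_o2) (rule isCont_F[OF X_mem[OF assms]])
  ultimately have "isCont (\<lambda>z. (X (fst z), snd z * exp (- F (X (fst z))))) z"
    by (intro continuous_intros)
  thus "isCont chart z" by (simp add: chart_def case_prod_unfold)
qed

lemma continuous_on_chart: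
  assumes "r < \<rho>"
  shows "continuous_on (cball 0 r) chart"
proof (intro continuous_at_imp_continuous_on ballI isCont_chart)
  fix z :: "real \<times> real" assume "z \<in> cball 0 r"
  thus "\<bar>fst z\<bar> < \<rho>" using norm_fst_le[of "fst z" "snd z"] assms by simp
qed

lemma open_disc: "open (disc r)"
proof -
  define S where "S = {-a<..<a} \<times> (UNIV :: real set)"
  define N where "N = (\<lambda>z. (\<xi> (fst z))\<^sup>2 + (snd z * exp (F (fst z)))\<^sup>2)"
  have "isCont N z" if "z \<in> S" for z
  proof -
    have x: "\<bar>fst z\<bar> < a" using that by (auto simp: S_def)
    have "isCont (\<lambda>z. \<xi> (fst z)) z" "isCont (\<lambda>z. F (fst z)) z"
      using isCont_o2[where f = fst and a = z, OF _ xi_cont[OF x]]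
        isCont_o2[where f = fst and a = z, OF _ isCont_F[OF x]]
      by (simp_all add: continuous_fst)
    thus ?thesis unfolding N_def by (intro continuous_intros)
  qed
  hence "continuous_on S N" by (intro continuous_at_imp_continuous_on) blast
  moreover have "open S" unfolding S_def by (intro open_Times) auto
  ultimately have "open (S \<inter> N -` {..<r\<^sup>2})" by (intro continuous_open_preimage) auto
  also have "S \<inter> N -` {..<r\<^sup>2} = disc r" by (auto simp: S_def N_def disc_def)
  finally show ?thesis .
qed

text \<open>In the coordinates \<open>(\<xi>, v)\<close> the system is the rotation
  \<open>\<xi>' = v / (1 + h(\<xi>))\<close>, \<open>v' = - \<xi> / (1 + h(\<xi>))\<close>.\<close>
lemma chart_solution:
  assumes s: "\<bar>s t\<bar> < \<rho>"
    and s': "(s has_real_derivative v t / (1 + h (s t))) (at t)"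
    and v': "(v has_real_derivative - s t / (1 + h (s t))) (at t)"
  shows "((\<lambda>t. chart (s t, v t)) has_vector_derivative lienard_field f g (chart (s t, v t))) (at t)"
proof -
  define x E u where "x = X (s t)" and "E = exp (- F (X (s t)))" and "u = 1 + h (s t)"
  have "u > 0" using h_pos[OF s] by (simp add: u_def)
  have "E > 0" by (simp add: E_def)
  have dx: "((\<lambda>t. X (s t)) has_real_derivative v t * E) (at t)"
    using DERIV_chain2[OF X_deriv[OF s] s'] \<open>u > 0\<close> by (simp add: E_def u_def mult.commute)
  have dF: "((\<lambda>t. F (X (s t))) has_real_derivative f x * (v t * E)) (at t)"
    unfolding x_def by (rule DERIV_chain2[OF F_deriv[OF X_mem[OF s]] dx])
  have "((\<lambda>t. v t * exp (- F (X (s t)))) has_real_derivative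
      - s t / u * E + v t * (E * - (f x * (v t * E)))) (at t)"
    unfolding E_def u_def
    by (rule derivative_eq_intros v' dF[unfolded E_def] refl)+ (simp add: x_def)
  also have "g x = E * s t / u"
  proof -
    have "g x * exp (F x) * u = s t" using force[OF s] by (simp add: x_def u_def)
    moreover have "exp (F x) * E = 1" by (simp add: x_def E_def flip: exp_add)
    ultimately have "g x * u = E * s t" by (metis mult.assoc mult.commute mult.right_neutral)
    thus ?thesis using \<open>u > 0\<close> by (simp add: field_simps)
  qed
  hence "- s t / u * E + v t * (E * - (f x * (v t * E))) = - g x - f x * (v t * E)\<^sup>2"
    by (simp add: power2_eq_square algebra_simps)
  finally have dy: "((\<lambda>t. v t * exp (- F (X (s t)))) has_real_derivative
      - g x - f x * (v t * E)\<^sup>2) (at t)" .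
  from has_vector_derivative_Pair[OF dx[unfolded has_real_derivative_iff_has_vector_derivative]
      dy[unfolded has_real_derivative_iff_has_vector_derivative]]
  show ?thesis by (simp add: chart_def lienard_field_def x_def E_def)
qed

lemma orbit_solution:
  assumes "0 < r" "r < \<rho>"
  shows "(orbit r has_vector_derivative lienard_field f g (orbit r t)) (at t)"
proof -
  have "((\<lambda>t. r * sin (angle r t)) has_real_derivative
      (r * cos (angle r t)) / (1 + h (r * sin (angle r t)))) (at t)"
    by (rule derivative_eq_intros angle_deriv[OF assms] refl)+ simp
  moreover have "((\<lambda>t. r * cos (angle r t)) has_real_derivative
      - (r * sin (angle r t)) / (1 + h (r * sin (angle r t)))) (at t)"
    by (rule derivative_eq_intros angle_deriv[OF assms] refl)+ simp
  ultimately show ?thesis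
    unfolding orbit_def
    by (rule chart_solution[where s = "\<lambda>t. r * sin (angle r t)" and v = "\<lambda>t. r * cos (angle r t)",
          OF abs_sin_less[OF assms]])
qed

text \<open>Returning to the same point of the circle means that the angle has advanced by a positive
  multiple of \<open>2 \<pi>\<close>, since it increases with time.\<close>
lemma orbit_least_period:
  assumes "0 < r" "r < \<rho>"
  shows "is_least_period (orbit r) (period r)"
  unfolding is_least_period_def
proof (intro conjI allI impI)
  show "is_period (orbit r) (period r)"
    unfolding is_period_def orbit_def by (simp add: period_pos[OF assms] angle_add_period[OF assms])
  fix T assume T: "is_period (orbit r) T"
  define \<alpha> \<beta> where "\<alpha> = angle r 0" and "\<beta> = angle r T"
  have "T > 0" using T by (simp add: is_period_def)
  have "orbit r T = orbit r 0" using T by (auto simp: is_period_def dest: spec[of _ 0])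
  from chart_inj[OF abs_sin_less[OF assms] abs_sin_less[OF assms] this[unfolded orbit_def]]
  have "sin \<beta> = sin \<alpha>" "cos \<beta> = cos \<alpha>" using \<open>0 < r\<close> by (auto simp: \<alpha>_def \<beta>_def)
  then obtain n :: int where n: "\<beta> = \<alpha> + 2 * pi * of_int n"
    using sin_cos_eq_iff[of \<beta> \<alpha>] by (auto elim: Ints_cases)
  have "time_fn r \<alpha> < time_fn r \<beta>"
    using \<open>T > 0\<close> by (simp add: \<alpha>_def \<beta>_def time_fn_angle[OF assms])
  hence "\<alpha> < \<beta>" using strict_mono_less[OF time_fn_strict_mono[OF assms]] by blast
  hence "n \<ge> 1" unfolding n by (simp add: zero_less_mult_iff)
  hence "\<alpha> + 2 * pi \<le> \<beta>" unfolding n by simp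
  hence "time_fn r (\<alpha> + 2 * pi) \<le> time_fn r \<beta>"
    using strict_mono_less_eq[OF time_fn_strict_mono[OF assms]] by blast
  thus "period r \<le> T"
    by (simp add: time_fn_add_2pi[OF assms] \<alpha>_def \<beta>_def time_fn_angle[OF assms])
qed

lemma range_orbit:
  assumes "0 < r" "r < \<rho>"
  shows "range (orbit r) = {chart (s, v) | s v. s\<^sup>2 + v\<^sup>2 = r\<^sup>2}"
proof (intro equalityI subsetI)
  fix q assume "q \<in> range (orbit r)"
  then obtain t where "q = chart (r * sin (angle r t), r * cos (angle r t))"
    by (auto simp: orbit_def)
  moreover have "(r * sin (angle r t))\<^sup>2 + (r * cos (angle r t))\<^sup>2 = r\<^sup>2"
    by (simp add: power_mult_distrib flip: distrib_left)
  ultimately show "q \<in> {chart (s, v) | s v. s\<^sup>2 + v\<^sup>2 = r\<^sup>2}" by blast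
next
  fix q assume "q \<in> {chart (s, v) | s v. s\<^sup>2 + v\<^sup>2 = r\<^sup>2}"
  then obtain s v where q: "q = chart (s, v)" "s\<^sup>2 + v\<^sup>2 = r\<^sup>2" by blast
  then obtain \<theta> where "s = r * sin \<theta>" "v = r * cos \<theta>"
    using polar_point \<open>0 < r\<close> by metis
  hence "q = orbit r (time_fn r \<theta>)" by (simp add: q orbit_def angle_time_fn[OF assms])
  thus "q \<in> range (orbit r)" by blast
qed

lemma range_orbit_subset_disc:
  assumes "0 < r" "r < r'" "r' \<le> \<rho>"
  shows "range (orbit r) \<subseteq> disc r'"
proof -
  have r: "r < \<rho>" "r\<^sup>2 < r'\<^sup>2" using assms by (auto intro: power_strict_mono)
  have "chart (s, v) \<in> disc r'" if "s\<^sup>2 + v\<^sup>2 = r\<^sup>2" for s v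
    using chart_mem_disc[OF abs_less_of_sum_squares[of s v r]] that r assms(1) by simp
  thus ?thesis by (auto simp: range_orbit[OF assms(1) r(1)])
qed

lemma orbit_avoids_origin:
  assumes "0 < r" "r < \<rho>"
  shows "(0, 0) \<notin> range (orbit r)"
proof
  assume "(0, 0) \<in> range (orbit r)"
  then obtain s v where sv: "chart (s, v) = chart (0, 0)" "s\<^sup>2 + v\<^sup>2 = r\<^sup>2"
    by (auto simp: range_orbit[OF assms] chart_0)
  have "\<bar>s\<bar> < \<rho>" using abs_less_of_sum_squares[of s v r] sv(2) assms by simp
  hence "s = 0" "v = 0" using chart_inj[OF _ _ sv(1)] rho_pos by auto
  thus False using sv(2) \<open>0 < r\<close> by simp
qed

text \<open>The open set \<open>disc r\<close> is bounded and its frontier lies on the orbit, being contained in the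
  image under \<open>chart\<close> of the closed disc minus the open one. A connected set that contains the origin
  and avoids the orbit can therefore not leave \<open>disc r\<close>.\<close>
lemma origin_inside_orbit:
  assumes "0 < r" "r < \<rho>"
  shows "(0, 0) \<in> inside (range (orbit r))"
proof -
  have norm_sq: "norm (s, v) \<le> r \<longleftrightarrow> s\<^sup>2 + v\<^sup>2 \<le> r\<^sup>2" for s v :: real
    using \<open>0 < r\<close> by (simp add: norm_Pair real_sqrt_le_iff' real_le_lsqrt sqrt_le_D)
  have sub: "disc r \<subseteq> chart ` cball 0 r"
  proof
    fix q assume "q \<in> disc r"
    then obtain s v where "q = chart (s, v)" "s\<^sup>2 + v\<^sup>2 < r\<^sup>2"
      using disc_chartE assms by (metis less_imp_le)
    thus "q \<in> chart ` cball 0 r" using norm_sq[of s v] by auto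
  qed
  have comp: "compact (chart ` cball 0 r)"
    by (intro compact_continuous_image continuous_on_chart assms compact_cball)
  have "closure (disc r) \<subseteq> chart ` cball 0 r"
    using sub comp by (intro closure_minimal compact_imp_closed)
  hence "frontier (disc r) \<subseteq> chart ` cball 0 r - disc r"
    using open_disc by (auto simp: frontier_def interior_open)
  also have "\<dots> \<subseteq> range (orbit r)"
  proof
    fix q assume "q \<in> chart ` cball 0 r - disc r"
    then obtain s v where q: "q = chart (s, v)" "s\<^sup>2 + v\<^sup>2 \<le> r\<^sup>2" "chart (s, v) \<notin> disc r"
      using norm_sq by auto
    hence "s\<^sup>2 + v\<^sup>2 = r\<^sup>2"
      using chart_mem_disc[OF abs_less_of_sum_squares[OF q(2) assms]] by auto
    thus "q \<in> range (orbit r)" using q by (auto simp: range_orbit[OF assms])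
  qed
  finally have fr: "frontier (disc r) \<subseteq> range (orbit r)" .
  define C where "C = connected_component_set (- range (orbit r)) (0, 0)"
  have "(0, 0) \<in> disc r" using chart_mem_disc[of 0 0 r] rho_pos \<open>0 < r\<close> by (simp add: chart_0)
  moreover have "(0, 0) \<in> C"
    using orbit_avoids_origin[OF assms] by (simp add: C_def)
  moreover have "C \<inter> frontier (disc r) = {}"
    using fr connected_component_subset[of "- range (orbit r)" "(0, 0)"] by (auto simp: C_def)
  moreover have "connected C" by (simp add: C_def)
  ultimately have "C \<subseteq> disc r"
    using connected_Int_frontier[of C "disc r"] by blast
  hence "bounded C" using sub comp by (meson bounded_subset compact_imp_bounded)
  thus ?thesis using orbit_avoids_origin[OF assms] by (simp add: inside_def C_def)
qed

text \<open>Uniqueness of solutions, without a Lipschitz estimate. In the coordinates \<open>(\<xi>, v)\<close> a solution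
  rotates with angular velocity \<open>\<omega>(t) = 1 / (1 + h(\<xi>(t)))\<close>. Turning it back by the angle
  \<open>\<Theta> = \<integral> \<omega>\<close> gives a constant vector \<open>(A, B)\<close>. So the solution lies on a circle with
  angle \<open>\<theta> = \<Theta> + const\<close>, and the time function of that circle along \<open>\<theta>\<close> has derivative \<open>1\<close>.\<close>
lemma solution_is_shifted_orbit:
  assumes sol: "\<And>t. (\<gamma> has_vector_derivative lienard_field f g (\<gamma> t)) (at t)"
    and ran: "range \<gamma> \<subseteq> disc R" and R: "0 < R" "R \<le> \<rho>"
    and nc: "\<not> \<gamma> constant_on UNIV"
  obtains r c where "0 < r" "r < R" "\<And>t. \<gamma> t = orbit r (t + c)"
proof -
  define x y where "x = (\<lambda>t. fst (\<gamma> t))" and "y = (\<lambda>t. snd (\<gamma> t))"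
  define s v where "s = (\<lambda>t. \<xi> (x t))" and "v = (\<lambda>t. y t * exp (F (x t)))"
  define \<omega> where "\<omega> = (\<lambda>t. 1 / (1 + h (s t)))"
  have mem: "\<bar>x t\<bar> < a" "(s t)\<^sup>2 + (v t)\<^sup>2 < R\<^sup>2" for t
    using ran by (auto simp: disc_def x_def y_def s_def v_def image_subset_iff split: prod.splits)
      (metis prod.collapse)+
  have s_less: "\<bar>s t\<bar> < \<rho>" for t
  proof -
    have "(s t)\<^sup>2 < R\<^sup>2" using mem(2)[of t] by (smt (verit) zero_le_power2)
    thus ?thesis using R power2_less_imp_less[of "\<bar>s t\<bar>" R] by simp
  qed
  have gamma: "\<gamma> t = chart (s t, v t)" for t
    using chart_surj[OF mem(1)[of t], of "y t"] by (simp add: s_def v_def x_def y_def)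
  have dx: "(x has_real_derivative y t) (at t)" for t
    using bounded_linear.has_vector_derivative[OF bounded_linear_fst sol[of t]]
    by (simp add: x_def y_def lienard_field_def has_real_derivative_iff_has_vector_derivative
        case_prod_beta)
  have dy: "(y has_real_derivative - g (x t) - f (x t) * (y t)\<^sup>2) (at t)" for t
    using bounded_linear.has_vector_derivative[OF bounded_linear_snd sol[of t]]
    by (simp add: x_def y_def lienard_field_def has_real_derivative_iff_has_vector_derivative
        case_prod_beta)
  have ds: "(s has_real_derivative \<omega> t * v t) (at t)" for t
  proof -
    have "(s has_real_derivative exp (F (x t)) / (1 + h (\<xi> (x t))) * y t) (at t)"
      unfolding s_def
      by (rule DERIV_chain2[OF xi_deriv dx]) (use mem s_less in \<open>auto simp: s_def\<close>)
    thus ?thesis by (simp add: \<omega>_def v_def s_def mult.commute)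
  qed
  have dv: "(v has_real_derivative - (\<omega> t * s t)) (at t)" for t
  proof -
    have "(v has_real_derivative (- g (x t) - f (x t) * (y t)\<^sup>2) * exp (F (x t)) +
        exp (F (x t)) * (f (x t) * y t) * y t) (at t)"
      unfolding v_def
      by (rule DERIV_mult[OF dy DERIV_chain2[OF DERIV_exp DERIV_chain2[OF F_deriv[OF mem(1)] dx]],
            THEN DERIV_cong]) simp
    moreover have "g (x t) * exp (F (x t)) = \<omega> t * s t"
    proof -
      have "X (s t) = x t" by (simp add: s_def X_xi[OF mem(1)])
      thus ?thesis using force[OF s_less[of t]] h_pos[OF s_less[of t]] by (simp add: \<omega>_def field_simps)
    qed
    ultimately show ?thesis by (simp add: power2_eq_square algebra_simps)
  qed
  have "isCont \<omega> t" for t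
  proof -
    have "isCont (\<lambda>t. h (s t)) t"
      by (rule isCont_o2[OF DERIV_isCont[OF ds] DERIV_isCont[OF h_deriv[OF s_less]]])
    thus ?thesis
      unfolding \<omega>_def using h_pos[OF s_less[of t]] by (intro continuous_intros) auto
  qed
  hence "\<exists>\<Theta>. \<forall>t::real. -\<infinity> < ereal t \<longrightarrow> ereal t < \<infinity> \<longrightarrow> (\<Theta> has_vector_derivative \<omega> t) (at t)"
    by (intro einterval_antiderivative) auto
  then obtain \<Theta> where \<Theta>: "\<And>t. (\<Theta> has_real_derivative \<omega> t) (at t)"
    by (auto simp: has_real_derivative_iff_has_vector_derivative)
  define A B where "A = (\<lambda>t. s t * cos (\<Theta> t) - v t * sin (\<Theta> t))"
    and "B = (\<lambda>t. s t * sin (\<Theta> t) + v t * cos (\<Theta> t))"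
  have "(A has_real_derivative 0) (at t)" for t
    unfolding A_def
    by (rule derivative_eq_intros ds dv \<Theta> refl)+ (simp add: algebra_simps)
  hence A: "A t = A 0" for t by (intro DERIV_isconst_all) auto
  have "(B has_real_derivative 0) (at t)" for t
    unfolding B_def
    by (rule derivative_eq_intros ds dv \<Theta> refl)+ (simp add: algebra_simps)
  hence B: "B t = B 0" for t by (intro DERIV_isconst_all) auto
  have sAB: "s t = A 0 * cos (\<Theta> t) + B 0 * sin (\<Theta> t)" for t
  proof -
    have "A t * cos (\<Theta> t) + B t * sin (\<Theta> t) = s t * (cos (\<Theta> t) * cos (\<Theta> t) + sin (\<Theta> t) * sin (\<Theta> t))"
      unfolding A_def B_def by (simp only: algebra_simps)
    from this[unfolded A[of t] B[of t] sin_cos_squared_add3] show ?thesis by simp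
  qed
  have vAB: "v t = B 0 * cos (\<Theta> t) - A 0 * sin (\<Theta> t)" for t
  proof -
    have "B t * cos (\<Theta> t) - A t * sin (\<Theta> t) = v t * (cos (\<Theta> t) * cos (\<Theta> t) + sin (\<Theta> t) * sin (\<Theta> t))"
      unfolding A_def B_def by (simp only: algebra_simps)
    from this[unfolded A[of t] B[of t] sin_cos_squared_add3] show ?thesis by simp
  qed
  define r where "r = sqrt ((A 0)\<^sup>2 + (B 0)\<^sup>2)"
  have r2: "(A 0)\<^sup>2 + (B 0)\<^sup>2 = r\<^sup>2" by (simp add: r_def)
  have "r > 0"
  proof (rule ccontr)
    assume "\<not> r > 0"
    hence "(A 0)\<^sup>2 + (B 0)\<^sup>2 \<le> 0" unfolding r_def by (simp only: real_sqrt_gt_0_iff not_less)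
    hence "A 0 = 0" "B 0 = 0" unfolding sum_power2_le_zero_iff by blast+
    hence "\<gamma> t = chart (0, 0)" for t by (simp add: gamma sAB vAB)
    thus False using nc by (auto simp: constant_on_def)
  qed
  obtain \<theta>0 where th: "A 0 = r * sin \<theta>0" "B 0 = r * cos \<theta>0"
    using polar_point[OF r2 \<open>r > 0\<close>] by blast
  define \<theta> where "\<theta> = (\<lambda>t. \<Theta> t + \<theta>0)"
  have s_eq: "s t = r * sin (\<theta> t)" and v_eq: "v t = r * cos (\<theta> t)" for t
    by (simp_all add: sAB vAB th \<theta>_def sin_add cos_add algebra_simps)
  have "(s 0)\<^sup>2 + (v 0)\<^sup>2 = r\<^sup>2"
    unfolding s_eq v_eq by (simp add: power_mult_distrib flip: distrib_left)
  hence "r\<^sup>2 < R\<^sup>2" using mem(2)[of 0] by simp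
  hence "r < R" using R(1) by (simp add: power2_less_imp_less)
  hence r: "0 < r" "r < \<rho>" using \<open>r > 0\<close> R by auto
  have "((\<lambda>t. time_fn r (\<theta> t) - t) has_real_derivative 0) (at t)" for t
  proof -
    have "(\<theta> has_real_derivative \<omega> t) (at t)"
      unfolding \<theta>_def by (rule derivative_eq_intros \<Theta> refl)+ simp
    hence "((\<lambda>t. time_fn r (\<theta> t)) has_real_derivative (1 + h (r * sin (\<theta> t))) * \<omega> t) (at t)"
      by (rule DERIV_chain2[OF time_fn_deriv[OF r]])
    moreover have "(1 + h (r * sin (\<theta> t))) * \<omega> t = 1"
      using h_pos[OF s_less[of t]] by (simp add: \<omega>_def s_eq)
    ultimately show ?thesis by (auto intro!: derivative_eq_intros)
  qed
  hence c: "time_fn r (\<theta> t) - t = time_fn r (\<theta> 0) - 0" for t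
    by (intro DERIV_isconst_all[of "\<lambda>t. time_fn r (\<theta> t) - t"] allI)
  have \<theta>_eq: "\<theta> t = angle r (t + time_fn r (\<theta> 0))" for t
    using angle_time_fn[OF r, of "\<theta> t"] c[of t] by (simp add: algebra_simps)
  have "\<gamma> t = orbit r (t + time_fn r (\<theta> 0))" for t
    unfolding gamma s_eq v_eq orbit_def \<theta>_eq[of t, symmetric] ..
  with \<open>r > 0\<close> \<open>r < R\<close> show ?thesis by (rule that)
qed

end

section \<open>Periods and isochronicity\<close>

lemma least_period_unique:
  assumes "is_least_period \<gamma> S" "is_least_period \<gamma> T"
  shows "S = T"
  using assms by (meson antisym is_least_period_def)

lemma least_period_imp_nonconstant:
  assumes "is_least_period \<gamma> T"
  shows "\<not> \<gamma> constant_on UNIV"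
proof
  assume "\<gamma> constant_on UNIV"
  hence "is_period \<gamma> (T / 2)"
    using assms by (auto simp: is_least_period_def is_period_def constant_on_def)
  hence "T \<le> T / 2" using assms unfolding is_least_period_def by blast
  moreover have "T > 0" using assms by (simp add: is_least_period_def is_period_def)
  ultimately show False by simp
qed

lemma is_period_shift: "is_period (\<lambda>t. \<gamma> (t + c)) T \<longleftrightarrow> is_period \<gamma> T"
proof -
  have "(\<forall>t. \<gamma> (t + T + c) = \<gamma> (t + c)) \<longleftrightarrow> (\<forall>t. \<gamma> (t + T) = \<gamma> t)"
    by (metis add.assoc add.commute diff_add_cancel)
  thus ?thesis by (simp add: is_period_def)
qed

context urabe_coordinates
begin

text \<open>On \<open>[0, \<pi>]\<close> the function \<open>\<tau>(\<theta>) - \<tau>(-\<theta>)\<close> grows from \<open>0\<close> to the period, and its derivative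
  involves only the even part of \<open>h\<close>. This replaces the expansion of the period as a power series
  in \<open>r\<close>.\<close>
lemma period_mean_value:
  assumes "0 < r" "r < \<rho>"
  obtains s where "0 < s" "s \<le> r" "period r = pi * (2 + (h s + h (- s)))"
proof -
  define D where "D = (\<lambda>\<theta>. time_fn r \<theta> - time_fn r (- \<theta>))"
  have "(D has_real_derivative 2 + (h (r * sin \<theta>) + h (- (r * sin \<theta>)))) (at \<theta>)" for \<theta>
  proof -
    have "((\<lambda>\<theta>. time_fn r (- \<theta>)) has_real_derivative (1 + h (r * sin (- \<theta>))) * (- 1)) (at \<theta>)"
      by (rule DERIV_chain2[OF time_fn_deriv[OF assms]]) (auto intro!: derivative_eq_intros)
    from DERIV_diff[OF time_fn_deriv[OF assms, of \<theta>] this] show ?thesis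
      unfolding D_def by simp
  qed
  from MVT2[OF pi_gt_zero this] obtain \<theta> where \<theta>: "0 < \<theta>" "\<theta> < pi"
    and "D pi - D 0 = (pi - 0) * (2 + (h (r * sin \<theta>) + h (- (r * sin \<theta>))))" by blast
  hence "period r = pi * (2 + (h (r * sin \<theta>) + h (- (r * sin \<theta>))))"
    by (simp add: D_def period_def)
  moreover have "0 < r * sin \<theta>" using sin_gt_zero[OF \<theta>] assms(1) by simp
  moreover have "r * sin \<theta> \<le> r" using assms(1) by (simp add: mult_left_le)
  ultimately show ?thesis using that by blast
qed

text \<open>By the mean value formula the even part of \<open>h\<close> takes a fixed value at points arbitrarily
  close to \<open>0\<close>. Continuity at \<open>0\<close> forces this value to be \<open>0\<close>, and then isolation of zeros makes the
  even part vanish identically.\<close>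
lemma constant_period_imp_odd:
  assumes h: "h has_fps_expansion H" and "0 < \<delta>" "\<delta> \<le> \<rho>"
    and const: "\<And>r. 0 < r \<Longrightarrow> r < \<delta> \<Longrightarrow> period r = T"
  shows "\<forall>\<^sub>F x in nhds 0. h (- x) = - h x"
proof -
  define E where "E = (\<lambda>x. h x + h (- x))"
  obtain EE where E: "E has_fps_expansion EE"
    using even_part_has_fps_expansion[OF h] unfolding E_def by blast
  have small: "\<exists>s. 0 < s \<and> s < e \<and> E s = T / pi - 2" if "e > 0" for e
  proof -
    define r where "r = min e \<delta> / 2"
    have "0 < r" "r < \<rho>" "r < e" "r < \<delta>" using assms that by (auto simp: r_def)
    moreover from this obtain s where "0 < s" "s \<le> r" "period r = pi * (2 + E s)"
      using period_mean_value by (metis E_def)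
    ultimately show ?thesis using const[of r]
      by (intro exI[of _ s]) (auto simp: field_simps)
  qed
  have freq: "\<exists>s. 0 < s \<and> E s = T / pi - 2 \<and> Q s" if "\<forall>\<^sub>F x in at 0. Q x" for Q
  proof -
    obtain e where "e > 0" "\<And>x. x \<noteq> 0 \<Longrightarrow> dist x 0 < e \<Longrightarrow> Q x"
      using \<open>\<forall>\<^sub>F x in at 0. Q x\<close> unfolding eventually_at by blast
    thus ?thesis using small[of e] by force
  qed
  \<comment> \<open>The fixed value \<open>T / \<pi> - 2\<close> is taken arbitrarily close to \<open>0\<close>, where the even part is small.\<close>
  have "T / pi - 2 = 0"
  proof (rule ccontr)
    assume "T / pi - 2 \<noteq> 0"
    moreover have "E 0 = 0" by (simp add: E_def h_0)
    moreover have "isCont E 0" using E by (rule has_fps_expansion_imp_continuous)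
    ultimately have "\<forall>\<^sub>F x in at 0. E x \<noteq> T / pi - 2"
      unfolding isCont_def by (intro tendsto_imp_eventually_ne) auto
    from freq[OF this] show False by blast
  qed
  have "EE = 0"
  proof (rule ccontr)
    assume "EE \<noteq> 0"
    from freq[OF has_fps_expansion_eventually_nonzero[OF E this]] show False
      using \<open>T / pi - 2 = 0\<close> by auto
  qed
  hence "\<forall>\<^sub>F x in nhds 0. 0 = E x" using E by (simp add: has_fps_expansion_def)
  thus ?thesis by eventually_elim (simp add: E_def)
qed

lemma orbit_periodic_solution:
  assumes "0 < r" "r < \<rho>" and S: "{(x, y). \<bar>x\<bar> < a} \<subseteq> S"
  shows "periodic_solution S (lienard_field f g) (orbit r)"
proof -
  have "orbit r t \<in> S" for t
    using S chart_inverse(3)[OF abs_sin_less[OF assms(1,2)]] 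
    by (auto simp: orbit_def subset_iff split: prod.splits) (metis prod.collapse)
  thus ?thesis
    using orbit_solution[OF assms(1,2)] orbit_least_period[OF assms(1,2)]
      least_period_imp_nonconstant
    unfolding periodic_solution_def is_least_period_def by blast
qed

text \<open>The orbits close to the origin are images of small circles, hence lie in any prescribed
  neighborhood. The common least period there makes \<^const>\<open>period\<close> constant for small radii.\<close>
lemma isochronous_imp_odd:
  assumes h: "h has_fps_expansion H" and S: "{(x, y). \<bar>x\<bar> < a} \<subseteq> S"
    and iso: "is_isochronous_center S (lienard_field f g) (0, 0)"
  shows "\<forall>\<^sub>F x in nhds 0. h (- x) = - h x"
proof -
  obtain U T where U: "open U" "(0, 0) \<in> U"
    and T: "\<And>\<gamma>. periodic_solution S (lienard_field f g) \<gamma> \<Longrightarrow> range \<gamma> \<subseteq> U \<Longrightarrow> is_least_period \<gamma> T"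
    using iso unfolding is_isochronous_center_def by blast
  have "isCont chart (0, 0)" using rho_pos by (intro isCont_chart) simp
  hence "\<forall>\<^sub>F z in nhds (0, 0). chart z \<in> U"
    using U unfolding isCont_def tendsto_at_iff_tendsto_nhds by (simp add: chart_0 topological_tendstoD)
  then obtain d where "d > 0" and d: "\<And>z. dist z (0, 0) < d \<Longrightarrow> chart z \<in> U"
    by (auto simp: eventually_nhds_metric)
  define \<delta> where "\<delta> = min d \<rho>"
  have "period r = T" if r: "0 < r" "r < \<delta>" for r
  proof -
    have r': "r < \<rho>" "r < d" using r by (auto simp: \<delta>_def)
    have "range (orbit r) \<subseteq> U"
    proof
      fix q assume "q \<in> range (orbit r)"
      then obtain s v where q: "q = chart (s, v)" "s\<^sup>2 + v\<^sup>2 = r\<^sup>2"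
        unfolding range_orbit[OF r(1) r'(1)] by blast
      have "dist (s, v) (0, 0) = r" using q(2) r(1) by (simp add: dist_Pair_Pair dist_real_def)
      thus "q \<in> U" using d r' q by simp
    qed
    from T[OF orbit_periodic_solution[OF r(1) r'(1) S] this] orbit_least_period[OF r(1) r'(1)]
    show ?thesis by (rule least_period_unique[symmetric])
  qed
  thus ?thesis
    using constant_period_imp_odd[OF h, of \<delta> T] \<open>d > 0\<close> rho_pos by (simp add: \<delta>_def)
qed

text \<open>The images of the circles fill a neighborhood of the origin. Any periodic solution in it is a
  time shift of one of them, and by oddness of \<open>h\<close> each of them has period \<open>2 \<pi>\<close>.\<close>
lemma odd_imp_isochronous:
  assumes odd: "\<forall>\<^sub>F x in nhds 0. h (- x) = - h x" and S: "{(x, y). \<bar>x\<bar> < a} \<subseteq> S"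
  shows "is_isochronous_center S (lienard_field f g) (0, 0)"
proof -
  obtain d where "d > 0" and d: "\<And>x. \<bar>x\<bar> \<le> d \<Longrightarrow> h (- x) = - h x"
    using odd by (rule eventually_nhds_0_interval) blast
  define R where "R = min d \<rho>"
  have R: "0 < R" "R \<le> \<rho>" "R \<le> d" using \<open>d > 0\<close> rho_pos by (auto simp: R_def)
  have period: "period r = 2 * pi" if r: "0 < r" "r < R" for r
  proof -
    have "r < \<rho>" using r R by simp
    then obtain s where "0 < s" "s \<le> r" "period r = pi * (2 + (h s + h (- s)))"
      using period_mean_value[OF r(1)] by metis
    thus ?thesis using d[of s] r R by simp
  qed
  have origin: "(0, 0) \<in> disc R" using chart_mem_disc[of 0 0 R] rho_pos R by (simp add: chart_0)
  have "is_center S (lienard_field f g) (0, 0)"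
    unfolding is_center_def
  proof (intro exI[of _ "disc R"] conjI ballI)
    fix q assume q: "q \<in> disc R - {(0, 0)}"
    then obtain s v where sv: "q = chart (s, v)" "s\<^sup>2 + v\<^sup>2 < R\<^sup>2"
      using disc_chartE[of q R] R by blast
    define r where "r = sqrt (s\<^sup>2 + v\<^sup>2)"
    have r2: "s\<^sup>2 + v\<^sup>2 = r\<^sup>2" by (simp add: r_def)
    have "(s, v) \<noteq> (0, 0)" using q sv chart_0 by auto
    hence "s\<^sup>2 + v\<^sup>2 > 0" by (simp add: sum_power2_gt_zero_iff)
    hence r: "0 < r" "r < R"
      using sv(2) R(1) by (auto simp: r_def intro: real_less_lsqrt)
    hence r': "r < \<rho>" using R by simp
    show "\<exists>\<gamma>. periodic_solution S (lienard_field f g) \<gamma> \<and> q \<in> range \<gamma> \<and>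
        range \<gamma> \<subseteq> disc R \<and> (0, 0) \<in> inside (range \<gamma>)"
    proof (intro exI conjI)
      show "periodic_solution S (lienard_field f g) (orbit r)"
        by (rule orbit_periodic_solution[OF r(1) r' S])
      show "q \<in> range (orbit r)"
        using sv(1) r2 unfolding range_orbit[OF r(1) r'] by blast
      show "range (orbit r) \<subseteq> disc R" by (rule range_orbit_subset_disc[OF r R(2)])
      show "(0, 0) \<in> inside (range (orbit r))" by (rule origin_inside_orbit[OF r(1) r'])
    qed
  qed (use origin open_disc in auto)
  moreover have "is_least_period \<gamma> (2 * pi)"
    if \<gamma>: "periodic_solution S (lienard_field f g) \<gamma>" "range \<gamma> \<subseteq> disc R" for \<gamma>
  proof -
    obtain r c where r: "0 < r" "r < R" and eq: "\<And>t. \<gamma> t = orbit r (t + c)"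
      using solution_is_shifted_orbit[of \<gamma> R] \<gamma> R unfolding periodic_solution_def by metis
    have "\<gamma> = (\<lambda>t. orbit r (t + c))" using eq by auto
    thus ?thesis using orbit_least_period[of r] period[OF r] r R
      by (simp add: is_least_period_def is_period_shift)
  qed
  ultimately show ?thesis
    unfolding is_isochronous_center_def using origin open_disc by blast
qed

end

section \<open>Comparison of the derivatives at the origin\<close>

theorem theorem3:
  fixes Nf Df Ng Dg :: "real poly" and f g :: "real \<Rightarrow> real"
  assumes "f = (\<lambda>x. poly Nf x / poly Df x)"
    and "g = (\<lambda>x. poly Ng x / poly Dg x)"
    and "poly Df 0 = 1" and "poly Dg 0 = 1"
    and "coprime Nf Df" and "coprime Ng Dg"
    and "g 0 = 0" and "(g has_real_derivative 1) (at 0)"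
    and "\<forall>\<^sub>F x in at 0. x * g x > 0"
  shows "(\<exists>M0::nat. M0 > 0 \<and> (\<forall>M \<ge> M0.
            is_isochronous_center {(x, y). poly Df x \<noteq> 0 \<and> poly Dg x \<noteq> 0}
              (lienard_field f g) (0, 0)
            \<longleftrightarrow> (\<exists>h. odd_analytic_at_0 h \<and>
                  (\<forall>k \<le> M. P_seq h k 0 = poly (Q_seq Nf Df Ng Dg k) 0))))
       \<and> (\<forall>M. (\<forall>h. odd_analytic_at_0 h \<longrightarrow>
                   (\<forall>k \<le> M. poly (P_trunc h M k) 0 = P_seq h k 0))
              \<and> (\<forall>k \<le> M. poly (Q_trunc Nf Df Ng Dg M k) 0 = poly (Q_seq Nf Df Ng Dg k) 0))"
proof (intro conjI allI impI)
  let ?S = "{(x, y). poly Df x \<noteq> 0 \<and> poly Dg x \<noteq> 0}"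
  have f_exp: "f has_fps_expansion (fps_of_poly Nf / fps_of_poly Df)"
    and g_exp: "g has_fps_expansion (fps_of_poly Ng / fps_of_poly Dg)"
    unfolding assms(1,2) using assms(3,4)
    by (auto intro!: has_fps_expansion_divide' has_fps_expansion_poly simp: poly_0_coeff_0)
  have good: "\<forall>\<^sub>F x in nhds 0. poly Df x \<noteq> 0 \<and> poly Dg x \<noteq> 0"
  proof (rule eventually_conj)
    have "\<forall>\<^sub>F x in nhds 0. poly p x \<noteq> 0" if "poly p 0 = 1" for p :: "real poly"
    proof -
      have "filterlim (poly p) (nhds (poly p 0)) (nhds 0)"
        using DERIV_isCont[OF poly_DERIV[of p 0]] by (simp add: isCont_def tendsto_at_iff_tendsto_nhds)
      thus ?thesis by (rule tendsto_imp_eventually_ne) (simp add: that)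
    qed
    thus "\<forall>\<^sub>F x in nhds 0. poly Df x \<noteq> 0" "\<forall>\<^sub>F x in nhds 0. poly Dg x \<noteq> 0"
      using assms(3,4) by blast+
  qed
  obtain F X \<xi> h a \<rho> H where coords: "urabe_coordinates f g F X \<xi> h a \<rho>"
    and h: "h has_fps_expansion H" and "F 0 = 0"
    and nz: "\<And>x. \<bar>x\<bar> < a \<Longrightarrow> poly Df x \<noteq> 0 \<and> poly Dg x \<noteq> 0"
    by (rule urabe_coordinates_exist[OF f_exp g_exp assms(7,8) good]) blast
  interpret urabe_coordinates f g F X \<xi> h a \<rho> by (rule coords)
  have S: "{(x, y). \<bar>x\<bar> < a} \<subseteq> ?S" using nz by auto
  have PQ: "P_seq h k 0 = poly (Q_seq Nf Df Ng Dg k) 0" for k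
    using P_seq_eq_Q_seq[OF assms(1,2) nz, of 0 k] rho_pos \<open>F 0 = 0\<close>
    by (simp add: X_0 h_0 assms(3,4))
  have H0: "fps_nth H 0 = 0" using has_fps_expansion_at_0[OF h] h_0 by simp
  show "\<exists>M0::nat. M0 > 0 \<and> (\<forall>M \<ge> M0. is_isochronous_center ?S (lienard_field f g) (0, 0)
            \<longleftrightarrow> (\<exists>h. odd_analytic_at_0 h \<and>
                  (\<forall>k \<le> M. P_seq h k 0 = poly (Q_seq Nf Df Ng Dg k) 0)))"
  proof (cases "\<forall>\<^sub>F x in nhds 0. h (- x) = - h x")
    case True
    hence "odd_analytic_at_0 h" using h by (auto simp: odd_analytic_at_0_def)
    with PQ odd_imp_isochronous[OF True S] show ?thesis by (intro exI[of _ 1]) auto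
  next
    case False
    then obtain n where n: "even n" "fps_nth H n \<noteq> 0"
      using odd_iff_even_coeffs_vanish[OF h] by blast
    \<comment> \<open>A matching odd function would share the nonzero coefficient of even order \<open>n\<close>.\<close>
    have "\<not> (\<exists>h. odd_analytic_at_0 h \<and> (\<forall>k \<le> M. P_seq h k 0 = poly (Q_seq Nf Df Ng Dg k) 0))"
      if "M \<ge> n + 1" for M
    proof
      assume "\<exists>h. odd_analytic_at_0 h \<and> (\<forall>k \<le> M. P_seq h k 0 = poly (Q_seq Nf Df Ng Dg k) 0)"
      then obtain h' H' where h': "h' has_fps_expansion H'" "\<forall>\<^sub>F x in nhds 0. h' (- x) = - h' x"
        and eq: "\<And>k. k \<le> M \<Longrightarrow> P_seq h' k 0 = P_seq h k 0"
        by (auto simp: odd_analytic_at_0_def PQ)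
      have even0: "fps_nth H' m = 0" if "even m" for m
        using odd_iff_even_coeffs_vanish[OF h'(1)] h'(2) that by blast
      have "fps_nth H n = fps_nth H' n"
      proof (rule formal_P_determines[OF H0 even0[of 0]])
        show "fps_nth (formal_P H k) 0 = fps_nth (formal_P H' k) 0" if "k \<le> M" for k
          using eq[OF that] by (simp add: P_seq_at_0[OF h] P_seq_at_0[OF h'(1)])
      qed (use that in auto)
      thus False using even0[OF n(1)] n(2) by simp
    qed
    moreover have "\<not> is_isochronous_center ?S (lienard_field f g) (0, 0)"
      using isochronous_imp_odd[OF h S] False by blast
    ultimately show ?thesis by (intro exI[of _ "n + 1"]) auto
  qed
next
  fix M k :: nat and h :: "real \<Rightarrow> real"
  assume "odd_analytic_at_0 h" "k \<le> M"
  then obtain H where "h has_fps_expansion H" by (auto simp: odd_analytic_at_0_def)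
  thus "poly (P_trunc h M k) 0 = P_seq h k 0"
    using coeff_P_trunc[of h H k M 0] \<open>k \<le> M\<close> by (simp add: P_seq_at_0 poly_0_coeff_0)
next
  fix M k assume "k \<le> (M::nat)"
  thus "poly (Q_trunc Nf Df Ng Dg M k) 0 = poly (Q_seq Nf Df Ng Dg k) 0"
    using coeff_Q_trunc[of k M 0] by (simp add: poly_0_coeff_0)
qed

end
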